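(* Let $d\in\mathbb N$, $p\in(1,\infty)$, let $w$ be a weight with $[w]_{A_p(\mathbb R^d)}<\infty$, let $f$ be a real-valued function with $\|f\|_{\rm BMO(\mathbb R^d)}<\infty$, and let $H$ be a linear operator satisfying the weighted bound $$\|v^{1/p}Hv^{-1/p}\|_{p,p}\le \mathcal F([v]_{A_p(\mathbb R^d)},p)\quad\text{for all } v\in A_p(\mathbb R^d),$$ where $\mathcal F(t,p)$ is continuous in $t\in[1,\infty)$. Put $w_\delta=we^{\delta f}$. Then there are $\delta_0>0$ depending only on $p,[w]_{A_p(\mathbb R^d)},\|f\|_{\rm BMO}$ (with $d$ fixed) and a constant $C<\infty$ depending only on $p,[w]_{A_p(\mathbb R^d)},\|f\|_{\rm BMO},\mathcal F$ (with $d$ fixed) such that $$\|w_\delta^{1/p}Hw_\delta^{-1/p}-w^{1/p}Hw^{-1/p}\|_{p,p}\le C|\delta|$$ for all real $\delta$ with $|\delta|<\delta_0$.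
   Context: $\|\cdot\|_{p,p}$ is the operator norm on $L^p(\mathbb R^d)$. For a weight $v$ (nonnegative, locally integrable), $[v]_{A_p(\mathbb R^d)}:=\sup_B\langle v\rangle_B\big(\langle v^{1/(1-p)}\rangle_B\big)^{p-1}$, supremum over balls $B\subset\mathbb R^d$, $\langle g\rangle_B:=\frac1{|B|}\int_B g\,dx$; $v\in A_p(\mathbb R^d)$ means this is finite. $\|f\|_{\rm BMO(\mathbb R^d)}:=\sup_B\langle|f-\langle f\rangle_B|\rangle_B$. In $v^{1/p}Hv^{-1/p}$, powers of $v$ act by multiplication; the weighted bound means that $H$ is bounded on $L^p(\mathbb R^d, v\,dx)$ for each $v\in A_p(\mathbb R^d)$ with norm at most $\mathcal F([v]_{A_p},p)$, with $H$ being one and the same operator for all $v$ (its actions agree on intersections of these weighted spaces). Functions may be complex-valued and $H$ is complex-linear. *)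

theory Defs
  imports "HOL-Analysis.Analysis"
begin

definition locally_integrable :: "('a::euclidean_space \<Rightarrow> real) \<Rightarrow> bool" where
  "locally_integrable g \<longleftrightarrow> (\<forall>K. compact K \<longrightarrow> g absolutely_integrable_on K)"

definition weight :: "('a::euclidean_space \<Rightarrow> real) \<Rightarrow> bool" where
  "weight v \<longleftrightarrow> (\<forall>x. 0 \<le> v x) \<and> locally_integrable v"

definition nn_average :: "('a::euclidean_space) set \<Rightarrow> ('a \<Rightarrow> ennreal) \<Rightarrow> ennreal" where
  "nn_average B g = (\<integral>\<^sup>+x\<in>B. g x \<partial>lebesgue) / emeasure lebesgue B"

definition average :: "('a::euclidean_space) set \<Rightarrow> ('a \<Rightarrow> real) \<Rightarrow> real" where
  "average B g = (LINT x:B|lebesgue. g x) / measure lebesgue B"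

text \<open>Powers with a positive exponent on \<open>[0, \<infinity>]\<close>.\<close>

definition ennpow :: "ennreal \<Rightarrow> real \<Rightarrow> ennreal" where
  "ennpow x a = (if x = top then top else ennreal (enn2real x powr a))"

text \<open>
  The power of \<open>v\<close> with exponent \<open>1 / (1 - p)\<close> is written as a reciprocal in \<^typ>\<open>ennreal\<close>,
  so that it is \<open>\<infinity>\<close>, and not \<open>0\<close> as with \<^const>\<open>powr\<close>, where \<open>v\<close> vanishes.
\<close>

definition Ap_const :: "real \<Rightarrow> ('a::euclidean_space \<Rightarrow> real) \<Rightarrow> ennreal" where
  "Ap_const p v =
     (SUP (c, r) \<in> UNIV \<times> {0<..}.
        nn_average (ball c r) (\<lambda>x. ennreal (v x)) *
        ennpow (nn_average (ball c r) (\<lambda>x. inverse (ennpow (ennreal (v x)) (1 / (p - 1))))) (p - 1))"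

text \<open>
  The last conjunct excludes only the zero weight, for which the supremum would be \<open>0 * \<infinity> = 0\<close>
  in \<^typ>\<open>ennreal\<close>. A weight in \<open>Ap p\<close> is then positive almost everywhere.
\<close>

definition Ap :: "real \<Rightarrow> ('a::euclidean_space \<Rightarrow> real) set" where
  "Ap p = {v. weight v \<and> Ap_const p v < top \<and> \<not> (AE x in lebesgue. v x = 0)}"

definition BMO_norm :: "('a::euclidean_space \<Rightarrow> real) \<Rightarrow> ennreal" where
  "BMO_norm f =
     (SUP (c, r) \<in> UNIV \<times> {0<..}.
        nn_average (ball c r) (\<lambda>x. ennreal \<bar>f x - average (ball c r) f\<bar>))"

definition BMO :: "('a::euclidean_space \<Rightarrow> real) set" where
  "BMO = {f. locally_integrable f \<and> BMO_norm f < top}"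

definition Lp :: "'a measure \<Rightarrow> real \<Rightarrow> ('a \<Rightarrow> complex) set" where
  "Lp M p = {g \<in> borel_measurable M. integrable M (\<lambda>x. norm (g x) powr p)}"

definition Lp_norm :: "'a measure \<Rightarrow> real \<Rightarrow> ('a \<Rightarrow> complex) \<Rightarrow> real" where
  "Lp_norm M p g = (LINT x|M. norm (g x) powr p) powr (1 / p)"

text \<open>
  The value is \<open>\<infinity>\<close> (the infimum of the empty set) unless \<open>T\<close> maps \<open>L\<^sup>p\<close> boundedly into itself.
\<close>

definition op_norm :: "real \<Rightarrow> (('a::euclidean_space \<Rightarrow> complex) \<Rightarrow> 'a \<Rightarrow> complex) \<Rightarrow> ennreal" where
  "op_norm p T =
     Inf {ennreal K |K. 0 \<le> K \<and>
       (\<forall>g \<in> Lp lebesgue p. T g \<in> Lp lebesgue p \<and>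
          Lp_norm lebesgue p (T g) \<le> K * Lp_norm lebesgue p g)}"

definition conj_op :: "real \<Rightarrow> ('a::euclidean_space \<Rightarrow> real) \<Rightarrow>
    (('a \<Rightarrow> complex) \<Rightarrow> 'a \<Rightarrow> complex) \<Rightarrow> ('a \<Rightarrow> complex) \<Rightarrow> 'a \<Rightarrow> complex" where
  "conj_op p v H g =
     (\<lambda>x. of_real (v x powr (1 / p)) * H (\<lambda>y. of_real (v y powr (- 1 / p)) * g y) x)"

text \<open>
  \<open>H\<close> acts on representatives; its values matter only up to null sets and only on the union of
  the spaces \<open>L\<^sup>p(v dx)\<close>, \<open>v \<in> Ap p\<close>. Using one function \<open>H\<close> for all these spaces encodes that
  the actions on them agree on intersections.
\<close>

definition weighted_linear_op ::
  "real \<Rightarrow> (('a::euclidean_space \<Rightarrow> complex) \<Rightarrow> 'a \<Rightarrow> complex) \<Rightarrow> bool" where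
  "weighted_linear_op p H \<longleftrightarrow>
     (\<forall>v \<in> Ap p. let L = Lp (density lebesgue (\<lambda>x. ennreal (v x))) p in
        (\<forall>g \<in> L. \<forall>h \<in> L. (AE x in lebesgue. g x = h x) \<longrightarrow> (AE x in lebesgue. H g x = H h x)) \<and>
        (\<forall>g \<in> L. \<forall>h \<in> L. AE x in lebesgue. H (\<lambda>y. g y + h y) x = H g x + H h x) \<and>
        (\<forall>g \<in> L. \<forall>c. AE x in lebesgue. H (\<lambda>y. c * g y) x = c * H g x))"

end

theory Submission
  imports Defs
begin

text \<open>
  For complex \<open>z\<close> let \<open>T z\<close> be the conjugate of \<open>H\<close> by the power \<open>1 / p\<close> of \<open>w * exp (z * f)\<close>. Since \<open>f\<close> is
  real, the imaginary part of \<open>z\<close> contributes only unimodular factors, so \<open>T z\<close> has the norm of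
  \<open>T (Re z)\<close>. If the weights \<open>w * exp (x * f)\<close> with \<open>\<bar>x\<bar> \<le> R\<close> have uniformly bounded \<open>Ap\<close> constants, then
  \<open>T\<close> is uniformly bounded on the disc of radius \<open>R\<close>, and as \<open>T\<close> is analytic, Cauchy's estimate bounds
  \<open>T \<delta> - T 0\<close> by a multiple of \<open>\<bar>\<delta>\<bar>\<close>. Operator-valued analyticity is avoided by truncating the
  exponential series, which makes \<open>T z g\<close> pointwise a polynomial in \<open>z\<close>, and averaging over roots of unity.

  The uniform \<open>Ap\<close> bound does not need the reverse Hoelder inequality. By Hoelder's inequality a subset
  of at most half the measure of a cube \<open>Q\<close> carries at most a fixed fraction \<open>\<theta> < 1\<close> of the mass that \<open>w\<close>
  gives to \<open>Q\<close>, and likewise for the dual weight \<open>w powr (- 1 / (p - 1))\<close>. Hence the stopping-time proof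
  of the John-Nirenberg inequality works for both of these measures and bounds the averages of
  \<open>w * exp (x * (f - c))\<close> and of its dual weight, where \<open>c\<close> is the average of \<open>f\<close> over \<open>Q\<close>; the constant factors
  coming from \<open>c\<close> cancel in the product.
\<close>

section \<open>Dyadic stopping cubes\<close>

text \<open>On the operator side the obstacle is that \<open>H g\<close> is determined only up to a
  null set that varies with g. At a fixed point y the map z -> \<open>T z g y\<close> thus has no
  meaning along a whole circle, and a contour integral would require jointly measurable
  representatives. The truncated series involve only finitely many functions \<open>S (u k)\<close>,
  and a polynomial of degree at most 2n is controlled by 2n + 1 of its values on the circle.
  Averages of these values, unlike maxima, pass through Minkowski's inequality. Since f is
  unbounded, powers of f times g may leave \<open>Lp\<close>; input and output are therefore cut off
  where f is large, and the resulting bound does not involve the level of the cut. On the weight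
  side, integrating the exponential against w itself, and not against Lebesgue measure, avoids
  separating w from \<open>exp (x * f)\<close> by Hoelder's inequality, which would call for
  integrability of a power of w above 1. The definitions use balls, the stopping argument uses
  cubes; each passage between them costs a factor depending only on p and the dimension.\<close>

definition cube :: "'a::euclidean_space \<Rightarrow> real \<Rightarrow> 'a set" where
  "cube a h = {y. \<forall>i\<in>Basis. a \<bullet> i \<le> y \<bullet> i \<and> y \<bullet> i < a \<bullet> i + h}"

lemma box_subset_cube: "box a (a + h *\<^sub>R One) \<subseteq> cube a h"
  and cube_subset_cbox: "cube a h \<subseteq> cbox a (a + h *\<^sub>R One)"
  by (auto simp: cube_def mem_box inner_simps less_imp_le)

lemma cube_borel [measurable]: "cube a h \<in> sets borel"
proof -
  have "cube a h = (\<Inter>i\<in>Basis. {y. a \<bullet> i \<le> y \<bullet> i \<and> y \<bullet> i < a \<bullet> i + h})"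
    by (auto simp: cube_def)
  moreover have "{y. a \<bullet> i \<le> y \<bullet> i \<and> y \<bullet> i < a \<bullet> i + h} \<in> sets borel" for i :: 'a
    by measurable
  ultimately show ?thesis by (auto intro!: sets.countable_INT'' countable_finite)
qed

lemma cube_lebesgue [measurable, simp]: "cube a h \<in> sets lebesgue"
  by (simp add: cube_borel)

lemma emeasure_cube:
  fixes a :: "'a::euclidean_space"
  assumes "0 \<le> h"
  shows "emeasure lebesgue (cube a h) = ennreal (h ^ DIM('a))"
proof -
  have "emeasure lborel (cube a h) \<ge> emeasure lborel (box a (a + h *\<^sub>R One))"
    by (intro emeasure_mono box_subset_cube) auto
  moreover have "emeasure lborel (cube a h) \<le> emeasure lborel (cbox a (a + h *\<^sub>R One))"
    by (intro emeasure_mono cube_subset_cbox) auto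
  ultimately show ?thesis
    using assms by (auto simp: emeasure_lborel_box_eq emeasure_lborel_cbox_eq inner_simps)
qed

text \<open>The lower corner of one of the 2^d dyadic children of a cube: S is the set of directions
  in which the upper half is taken, so that subsets of \<open>Basis\<close> index the
  children.\<close>

definition half_corner :: "'a::euclidean_space \<Rightarrow> real \<Rightarrow> 'a set \<Rightarrow> 'a" where
  "half_corner a h S = a + (h / 2) *\<^sub>R (\<Sum>S)"

lemma half_corner_inner:
  assumes "S \<subseteq> Basis" "i \<in> Basis"
  shows "half_corner a h S \<bullet> i = a \<bullet> i + (if i \<in> S then h / 2 else 0)"
proof -
  have fin: "finite S" using assms(1) finite_Basis finite_subset by blast
  have "(\<Sum>S) \<bullet> i = (\<Sum>j\<in>S. j \<bullet> i)" by (simp add: inner_sum_left)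
  also have "\<dots> = (\<Sum>j\<in>S. if j = i then 1 else 0)"
    using assms by (intro sum.cong) (auto simp: inner_Basis)
  finally show ?thesis using fin by (simp add: half_corner_def inner_simps)
qed

lemma cube_halves:
  assumes "0 < h"
  shows "cube a h = (\<Union>S\<in>Pow Basis. cube (half_corner a h S) (h / 2))"
proof (intro set_eqI iffI)
  fix y assume y: "y \<in> cube a h"
  let ?S = "{i\<in>Basis. a \<bullet> i + h / 2 \<le> y \<bullet> i}"
  have "y \<in> cube (half_corner a h ?S) (h / 2)"
    using y by (auto simp: cube_def half_corner_inner)
  then show "y \<in> (\<Union>S\<in>Pow Basis. cube (half_corner a h S) (h / 2))"
    by (intro UN_I[of ?S]) auto
next
  fix y assume "y \<in> (\<Union>S\<in>Pow Basis. cube (half_corner a h S) (h / 2))"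
  then obtain S where S: "S \<subseteq> Basis" "y \<in> cube (half_corner a h S) (h / 2)" by blast
  show "y \<in> cube a h"
    unfolding cube_def
  proof (intro CollectI ballI)
    fix i :: 'a assume i: "i \<in> Basis"
    then have "half_corner a h S \<bullet> i \<le> y \<bullet> i \<and> y \<bullet> i < half_corner a h S \<bullet> i + h / 2"
      using S by (auto simp: cube_def)
    then show "a \<bullet> i \<le> y \<bullet> i \<and> y \<bullet> i < a \<bullet> i + h"
      using S i assms by (auto simp: half_corner_inner split: if_splits)
  qed
qed

lemma half_subset_cube:
  assumes "0 < h" "S \<subseteq> Basis"
  shows "cube (half_corner a h S) (h / 2) \<subseteq> cube a h"
  unfolding cube_halves[OF assms(1), of a] using assms(2) by (intro UN_upper) auto

text \<open>Half-open cubes make the children genuinely disjoint; with \<open>cube_halves\<close>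
  they partition the parent without exceptional null sets, and sums over children are exact for
  every measure.\<close>

lemma disjoint_halves:
  "disjoint_family_on (\<lambda>S. cube (half_corner a h S) (h / 2)) (Pow (Basis :: 'a::euclidean_space set))"
proof (unfold disjoint_family_on_def, intro ballI impI)
  fix S T :: "'a set" assume ST: "S \<in> Pow Basis" "T \<in> Pow Basis" "S \<noteq> T"
  then obtain i where i: "i \<in> Basis" "(i \<in> S) \<noteq> (i \<in> T)" by blast
  have False if "y \<in> cube (half_corner a h S) (h / 2)" "y \<in> cube (half_corner a h T) (h / 2)" for y
  proof -
    have "half_corner a h S \<bullet> i \<le> y \<bullet> i \<and> y \<bullet> i < half_corner a h S \<bullet> i + h / 2"
      "half_corner a h T \<bullet> i \<le> y \<bullet> i \<and> y \<bullet> i < half_corner a h T \<bullet> i + h / 2"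
      using that i(1) by (auto simp: cube_def)
    then show False using i ST by (auto simp: half_corner_inner split: if_splits)
  qed
  then show "cube (half_corner a h S) (h / 2) \<inter> cube (half_corner a h T) (h / 2) = {}" by blast
qed

text \<open>The Calderon-Zygmund selection cut off after n generations: the union of the maximal
  dyadic subcubes of generations 1 to n that satisfy P. The cube itself is never tested. Recursion
  on the union replaces the bookkeeping for a family of selected cubes.\<close>

primrec stop_set :: "('a::euclidean_space \<Rightarrow> real \<Rightarrow> bool) \<Rightarrow> nat \<Rightarrow> 'a \<Rightarrow> real \<Rightarrow> 'a set" where
  "stop_set P 0 a h = {}"
| "stop_set P (Suc n) a h =
     (\<Union>S\<in>Pow Basis. if P (half_corner a h S) (h / 2) then cube (half_corner a h S) (h / 2)
        else stop_set P n (half_corner a h S) (h / 2))"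

lemma stop_set_subset: "0 < h \<Longrightarrow> stop_set P n a h \<subseteq> cube a h"
proof (induction n arbitrary: a h)
  case (Suc n)
  then have "stop_set P n (half_corner a h S) (h / 2) \<subseteq> cube (half_corner a h S) (h / 2)" for S
    by simp
  then show ?case
    unfolding stop_set.simps cube_halves[OF Suc.prems] by (intro UN_mono) (auto split: if_splits)
qed simp

lemma stop_set_sets [measurable, simp]: "stop_set P n a h \<in> sets lebesgue"
  by (induction n arbitrary: a h) (auto intro!: sets.finite_UN)

lemma stop_set_Suc_mono: "0 < h \<Longrightarrow> stop_set P n a h \<subseteq> stop_set P (Suc n) a h"
proof (induction n arbitrary: a h)
  case (Suc n)
  then have sub: "stop_set P n (half_corner a h S) (h / 2) \<subseteq> stop_set P (Suc n) (half_corner a h S) (h / 2)" for S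
    by (simp del: stop_set.simps)
  show ?case
  proof
    fix y assume "y \<in> stop_set P (Suc n) a h"
    then obtain S where "S \<in> Pow Basis" "y \<in> (if P (half_corner a h S) (h / 2)
        then cube (half_corner a h S) (h / 2) else stop_set P n (half_corner a h S) (h / 2))"
      unfolding stop_set.simps by blast
    then have "S \<in> Pow Basis" "y \<in> (if P (half_corner a h S) (h / 2)
        then cube (half_corner a h S) (h / 2) else stop_set P (Suc n) (half_corner a h S) (h / 2))"
      using sub by (auto simp del: stop_set.simps split: if_splits)
    then show "y \<in> stop_set P (Suc (Suc n)) a h"
      unfolding stop_set.simps(2)[of P "Suc n" a h] by blast
  qed
qed simp

text \<open>Disjointness of the children turns a comparison of two measures on each selected cube
  into one on the whole stopping set. The comparison is asked only of cubes whose parent is not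
  selected; this is what later limits the jump of the averages of f at a selected cube.\<close>

lemma stop_set_measure_le:
  fixes a :: "'a::euclidean_space"
  assumes sets: "sets M = sets lebesgue" "sets M' = sets lebesgue"
    and step: "\<And>a h S. 0 < h \<Longrightarrow> \<not> P a h \<Longrightarrow> S \<subseteq> Basis \<Longrightarrow> P (half_corner a h S) (h / 2) \<Longrightarrow>
       emeasure M (cube (half_corner a h S) (h / 2)) \<le> emeasure M' (cube (half_corner a h S) (h / 2))"
  shows "0 < h \<Longrightarrow> \<not> P a h \<Longrightarrow> emeasure M (stop_set P n a h) \<le> emeasure M' (stop_set P n a h)"
proof (induction n arbitrary: a h)
  case (Suc n)
  define V where "V S = (if P (half_corner a h S) (h / 2) then cube (half_corner a h S) (h / 2)
        else stop_set P n (half_corner a h S) (h / 2))" for S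
  have V: "V S \<in> sets lebesgue" for S by (auto simp: V_def)
  have sub: "V S \<subseteq> cube (half_corner a h S) (h / 2)" for S
    using stop_set_subset[of "h / 2" P n "half_corner a h S"] Suc.prems by (auto simp: V_def)
  have dis: "disjoint_family_on V (Pow Basis)"
    using disjoint_halves[of a h] sub unfolding disjoint_family_on_def by blast
  have "emeasure M (\<Union>S\<in>Pow Basis. V S) = (\<Sum>S\<in>Pow Basis. emeasure M (V S))"
    by (rule sum_emeasure[symmetric]) (use V dis sets in auto)
  also have "\<dots> \<le> (\<Sum>S\<in>Pow Basis. emeasure M' (V S))"
  proof (rule sum_mono)
    fix S :: "'a set" assume "S \<in> Pow Basis"
    then show "emeasure M (V S) \<le> emeasure M' (V S)"
      using step[of h a S] Suc.IH[of "h/2" "half_corner a h S"] Suc.prems by (auto simp: V_def)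
  qed
  also have "\<dots> = emeasure M' (\<Union>S\<in>Pow Basis. V S)"
    by (rule sum_emeasure) (use V dis sets in auto)
  finally show ?case by (simp add: V_def)
qed simp

text \<open>Supplies, for points outside the stopping sets, arbitrarily small unselected cubes, the
  input for Lebesgue differentiation.\<close>

lemma not_stopped_cube:
  "0 < h \<Longrightarrow> \<not> P a h \<Longrightarrow> y \<in> cube a h \<Longrightarrow> y \<notin> stop_set P n a h \<Longrightarrow>
    \<exists>b. y \<in> cube b (h / 2 ^ n) \<and> \<not> P b (h / 2 ^ n)"
proof (induction n arbitrary: a h)
  case 0
  then show ?case by auto
next
  case (Suc n)
  obtain S where S: "S \<in> Pow Basis" "y \<in> cube (half_corner a h S) (h / 2)"
    using Suc.prems cube_halves by blast
  then have "\<not> P (half_corner a h S) (h / 2)" "y \<notin> stop_set P n (half_corner a h S) (h / 2)"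
    using Suc.prems by (auto split: if_splits)
  from Suc.IH[OF _ this(1) S(2) this(2)] Suc.prems show ?case by simp
qed

section \<open>A weighted John-Nirenberg inequality\<close>

lemma locally_integrable_measurable:
  fixes g :: "'a::euclidean_space \<Rightarrow> real"
  assumes "locally_integrable g"
  shows "g \<in> borel_measurable lebesgue"
proof -
  have 1: "set_integrable lebesgue (cball 0 (real n)) g" for n
    using assms compact_cball unfolding locally_integrable_def by blast
  have 2: "(\<lambda>x. indicator (cball 0 (real n)) x *\<^sub>R g x) \<in> borel_measurable lebesgue" for n
    using 1[of n] unfolding set_integrable_def by (rule borel_measurable_integrable)
  have 3: "(\<lambda>n. indicator (cball 0 (real n)) x *\<^sub>R g x) \<longlonglongrightarrow> g x" for x
  proof (rule tendsto_eventually)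
    obtain m :: nat where m: "norm x \<le> real m" using real_arch_simple by blast
    have "indicator (cball 0 (real n)) x *\<^sub>R g x = g x" if "m \<le> n" for n
    proof -
      have "norm x \<le> real n" using m that by linarith
      then show ?thesis by simp
    qed
    then show "\<forall>\<^sub>F n in sequentially. indicator (cball 0 (real n)) x *\<^sub>R g x = g x"
      unfolding eventually_sequentially by blast
  qed
  show ?thesis
    by (rule borel_measurable_LIMSEQ_real[where u = "\<lambda>n x. indicator (cball 0 (real n)) x *\<^sub>R g x"]) (rule 3 2)+
qed

lemma locally_integrable_bounded:
  assumes "locally_integrable g" "bounded S" "S \<in> sets lebesgue"
  shows "set_integrable lebesgue S g"
proof -
  obtain r where r: "S \<subseteq> cball 0 r"
    using bounded_subset_ballD[OF assms(2), of 0] ball_subset_cball by blast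
  have "set_integrable lebesgue (cball 0 r) g"
    using assms(1) compact_cball unfolding locally_integrable_def by blast
  then show ?thesis
    by (rule set_integrable_subset) (use assms(3) r in auto)
qed

lemma bounded_cube: "bounded (cube a h)"
  by (rule bounded_subset[OF bounded_cbox cube_subset_cbox])

lemma measure_cube:
  fixes a :: "'a::euclidean_space"
  assumes "0 \<le> h"
  shows "measure lborel (cube a h) = h ^ DIM('a)"
proof -
  have "emeasure lborel (cube a h) = ennreal (h ^ DIM('a))"
    using emeasure_cube[OF assms, of a] by simp
  then show ?thesis using assms by (simp add: measure_def)
qed

lemma average_deviation:
  fixes f :: "'a::euclidean_space \<Rightarrow> real"
  assumes f: "locally_integrable f" and "bounded B" "B \<in> sets lebesgue" "measure lebesgue B > 0"
  shows "ennreal (\<bar>average B f - c\<bar> * measure lebesgue B)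
    \<le> (\<integral>\<^sup>+x\<in>B. ennreal \<bar>f x - c\<bar> \<partial>lebesgue)"
proof -
  have fin: "emeasure lebesgue B < \<infinity>"
    using bounded_set_imp_lmeasurable[OF assms(2,3)] by (auto simp: fmeasurable_def)
  have int: "set_integrable lebesgue B f"
    using assms locally_integrable_bounded by blast
  have intc: "set_integrable lebesgue B (\<lambda>x. c)"
    using fin assms by (simp add: set_integrable_def)
  have int2: "set_integrable lebesgue B (\<lambda>x. f x - c)"
    using int intc by (rule set_integral_diff(1))
  have "(LINT x:B|lebesgue. f x - c) = (LINT x:B|lebesgue. f x) - (LINT x:B|lebesgue. c)"
    using int intc by (rule set_integral_diff(2))
  also have "(LINT x:B|lebesgue. c) = c * measure lebesgue B"
    using fin assms by (simp add: set_lebesgue_integral_def)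
  finally have "(average B f - c) * measure lebesgue B = (LINT x:B|lebesgue. f x - c)"
    using assms(4) by (simp add: average_def left_diff_distrib)
  then have "\<bar>average B f - c\<bar> * measure lebesgue B = \<bar>LINT x:B|lebesgue. f x - c\<bar>"
    by (metis abs_mult abs_of_nonneg measure_nonneg)
  also have "\<dots> \<le> (LINT x|lebesgue. \<bar>indicator B x *\<^sub>R (f x - c)\<bar>)"
    unfolding set_lebesgue_integral_def by (rule integral_abs_bound)
  finally have "ennreal (\<bar>average B f - c\<bar> * measure lebesgue B)
      \<le> ennreal (LINT x|lebesgue. \<bar>indicator B x *\<^sub>R (f x - c)\<bar>)"
    by (rule ennreal_leI)
  also have "\<dots> = (\<integral>\<^sup>+x. ennreal \<bar>indicator B x *\<^sub>R (f x - c)\<bar> \<partial>lebesgue)"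
    using int2 by (intro nn_integral_eq_integral[symmetric]) (auto simp: set_integrable_def)
  also have "\<dots> = (\<integral>\<^sup>+x\<in>B. ennreal \<bar>f x - c\<bar> \<partial>lebesgue)"
    by (intro nn_integral_cong) (auto split: split_indicator)
  finally show ?thesis .
qed

text \<open>The BMO condition over cubes, multiplied out by the volume and with a real
  bound.\<close>

definition cube_osc_bound :: "('a::euclidean_space \<Rightarrow> real) \<Rightarrow> real \<Rightarrow> bool" where
  "cube_osc_bound f N \<longleftrightarrow> 0 \<le> N \<and> (\<forall>a h. 0 < h \<longrightarrow>
     (\<integral>\<^sup>+x\<in>cube a h. ennreal \<bar>f x - average (cube a h) f\<bar> \<partial>lebesgue) \<le> ennreal (N * h ^ DIM('a)))"

text \<open>Halving the side divides the volume by 2^d, so the mean deviation from the large average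
  grows by at most that factor. The small cube may sit anywhere in the large one; non-dyadic
  positions occur in the differentiation argument.\<close>

lemma half_cube_average_diff:
  fixes a b :: "'a::euclidean_space"
  assumes f: "locally_integrable f" and osc: "cube_osc_bound f N"
    and sub: "cube b (h / 2) \<subseteq> cube a h" and h: "0 < h"
  shows "\<bar>average (cube b (h / 2)) f - average (cube a h) f\<bar> \<le> 2 ^ DIM('a) * N"
proof -
  let ?c = "average (cube a h) f"
  have "ennreal (\<bar>average (cube b (h / 2)) f - ?c\<bar> * (h / 2) ^ DIM('a))
      \<le> (\<integral>\<^sup>+x\<in>cube b (h / 2). ennreal \<bar>f x - ?c\<bar> \<partial>lebesgue)"
    using average_deviation[OF f bounded_cube cube_lebesgue, of b "h / 2" ?c] h
    by (simp add: measure_cube)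
  also have "\<dots> \<le> (\<integral>\<^sup>+x\<in>cube a h. ennreal \<bar>f x - ?c\<bar> \<partial>lebesgue)"
    using sub by (intro nn_integral_mono) (auto split: split_indicator)
  also have "\<dots> \<le> ennreal (N * h ^ DIM('a))"
    using osc h unfolding cube_osc_bound_def by blast
  finally have "\<bar>average (cube b (h / 2)) f - ?c\<bar> * (h / 2) ^ DIM('a) \<le> N * h ^ DIM('a)"
    using osc h by (subst (asm) ennreal_le_iff) (auto simp: cube_osc_bound_def)
  then have "\<bar>average (cube b (h / 2)) f - ?c\<bar> * h ^ DIM('a) \<le> (2 ^ DIM('a) * N) * h ^ DIM('a)"
    by (simp add: power_divide field_simps)
  then show ?thesis using h by simp
qed

text \<open>Differentiation is applied to cubes with lower corner y, while the stopping argument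
  provides cubes that merely contain y. Two such cubes of side k lie in a common cube of side 2k,
  and comparing both averages with its average costs \<open>2 * (2 ^ DIM('a) * N)\<close>. The
  exceptional set is fixed before h, c and L, so that one null set serves every stopping
  construction.\<close>

lemma AE_close_to_small_cube_averages:
  fixes f :: "'a::euclidean_space \<Rightarrow> real"
  assumes f: "locally_integrable f" and osc: "cube_osc_bound f N"
  shows "AE y in lebesgue. \<forall>h>0. \<forall>c L. (\<forall>n. \<exists>b. y \<in> cube b (h / 2 ^ n) \<and>
      \<bar>average (cube b (h / 2 ^ n)) f - c\<bar> \<le> L) \<longrightarrow> \<bar>f y - c\<bar> \<le> L + 2 * (2 ^ DIM('a) * N)"
proof -
  have int: "f integrable_on cbox a b" for a b
    using f by (intro set_lebesgue_integral_eq_integral locally_integrable_bounded) auto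
  have "\<exists>Z. negligible Z \<and> (\<forall>x e. x \<notin> Z \<longrightarrow> 0 < e \<longrightarrow> (\<exists>d>0. \<forall>h. 0 < h \<and> h < d \<longrightarrow>
      norm (integral (cbox x (x + h *\<^sub>R One)) f /\<^sub>R h ^ DIM('a) - f x) < e))"
    by (rule integrable_ccontinuous_explicit[OF int], (rule exI conjI)+, assumption,
        intro allI impI, assumption)
  then obtain Z where Z: "negligible Z" "\<forall>x e. x \<notin> Z \<longrightarrow> 0 < e \<longrightarrow> (\<exists>d>0. \<forall>h. 0 < h \<and> h < d \<longrightarrow>
      norm (integral (cbox x (x + h *\<^sub>R One)) f /\<^sub>R h ^ DIM('a) - f x) < e)"
    by (elim exE conjE)
  have avg: "integral (cbox x (x + k *\<^sub>R One)) f /\<^sub>R k ^ DIM('a) = average (cube x k) f"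
    if "0 < k" for x k
  proof -
    have "(LINT y:cube x k|lebesgue. f y) = integral (cube x k) f"
      using f bounded_cube by (intro set_lebesgue_integral_eq_integral locally_integrable_bounded) auto
    also have "\<dots> = integral (cbox x (x + k *\<^sub>R One)) f"
    proof (rule integral_spike_set)
      show "negligible {y \<in> cube x k - cbox x (x + k *\<^sub>R One). f y \<noteq> 0}"
        using cube_subset_cbox[of x k] by (auto intro: negligible_subset[of "{}"])
      show "negligible {y \<in> cbox x (x + k *\<^sub>R One) - cube x k. f y \<noteq> 0}"
        by (rule negligible_subset[OF negligible_frontier_interval[of x "x + k *\<^sub>R One"]])
          (use box_subset_cube[of x k] in auto)
    qed
    finally show ?thesis using that by (simp add: average_def measure_cube field_simps)
  qed
  have bound: "\<bar>f y - c\<bar> \<le> L + 2 * (2 ^ DIM('a) * N)"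
    if y: "y \<notin> Z" and h: "0 < h" and b: "\<And>n. \<exists>b. y \<in> cube b (h / 2 ^ n) \<and>
      \<bar>average (cube b (h / 2 ^ n)) f - c\<bar> \<le> L" for y h c L
  proof (rule field_le_epsilon)
    fix e :: real assume "0 < e"
    obtain d where d: "0 < d" and "\<forall>h. 0 < h \<and> h < d \<longrightarrow>
        norm (integral (cbox y (y + h *\<^sub>R One)) f /\<^sub>R h ^ DIM('a) - f y) < e"
      using Z(2)[rule_format, OF y \<open>0 < e\<close>] by (elim exE conjE)
    then have d2: "\<bar>average (cube y k) f - f y\<bar> < e" if "0 < k" "k < d" for k
      using that avg[OF that(1)] by (metis real_norm_def)
    have "(\<lambda>n. h * (1 / 2) ^ n) \<longlonglongrightarrow> h * 0"
      by (intro tendsto_intros LIMSEQ_realpow_zero) auto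
    then have "\<forall>\<^sub>F n in sequentially. h * (1 / 2) ^ n < d"
      using d by (intro order_tendstoD) auto
    then obtain n where n: "h * (1 / 2) ^ n < d"
      using eventually_happens'[OF sequentially_bot] by blast
    define k where "k = h / 2 ^ n"
    have k: "0 < k" "k < d" using h n by (auto simp: k_def power_one_over field_simps)
    obtain b where b: "y \<in> cube b k" "\<bar>average (cube b k) f - c\<bar> \<le> L"
      using b[of n] unfolding k_def[symmetric] by (elim exE conjE)
    \<comment> \<open>In each coordinate y exceeds the corner b by less than k, so the cube of side
      k starting at y stays below b + 2k.\<close>
    have "cube y k \<subseteq> cube b (2 * k)"
    proof
      fix z assume z: "z \<in> cube y k"
      have "b \<bullet> i \<le> z \<bullet> i \<and> z \<bullet> i < b \<bullet> i + 2 * k" if "i \<in> Basis" for i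
      proof -
        have "y \<bullet> i \<le> z \<bullet> i" "z \<bullet> i < y \<bullet> i + k" "b \<bullet> i \<le> y \<bullet> i" "y \<bullet> i < b \<bullet> i + k"
          using z b(1) that by (auto simp: cube_def)
        then show ?thesis by linarith
      qed
      then show "z \<in> cube b (2 * k)" by (simp add: cube_def)
    qed
    moreover have "cube b k \<subseteq> cube b (2 * k)"
      using k half_subset_cube[of "2 * k" "{}" b] by (simp add: half_corner_def)
    ultimately have "\<bar>average (cube y k) f - average (cube b (2 * k)) f\<bar> \<le> 2 ^ DIM('a) * N"
      "\<bar>average (cube b k) f - average (cube b (2 * k)) f\<bar> \<le> 2 ^ DIM('a) * N"
      using half_cube_average_diff[OF f osc, of _ "2 * k" b] k by auto
    with d2[OF k] b(2) show "\<bar>f y - c\<bar> \<le> L + 2 * (2 ^ DIM('a) * N) + e" by linarith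
  qed
  have "AE y in lebesgue. y \<notin> Z"
    using Z(1) by (simp add: AE_not_in negligible_iff_null_sets)
  then show ?thesis
  proof (rule eventually_mono, intro allI impI)
    fix y c L and h :: real
    assume *: "y \<notin> Z" "0 < h" "\<forall>n. \<exists>b. y \<in> cube b (h / 2 ^ n) \<and>
      \<bar>average (cube b (h / 2 ^ n)) f - c\<bar> \<le> L"
    show "\<bar>f y - c\<bar> \<le> L + 2 * (2 ^ DIM('a) * N)"
      by (rule bound[OF *(1,2) *(3)[rule_format]])
  qed
qed

text \<open>The truncation at \<open>K\<close> gives the trivial constant \<open>exp (t * K)\<close> to start from; this step improves any
  constant \<open>C\<close> to \<open>B + q * C\<close> with \<open>q < 1\<close> and \<open>B\<close> independent of \<open>K\<close>, so iteration removes the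
  dependence on \<open>K\<close>.\<close>

lemma weighted_John_Nirenberg_truncated_step:
  fixes f :: "'a::euclidean_space \<Rightarrow> real" and W :: "'a \<Rightarrow> ennreal"
  assumes f: "locally_integrable f" and osc: "cube_osc_bound f N" and N: "0 < N"
    and W [measurable]: "W \<in> borel_measurable lebesgue"
    and \<theta>: "0 \<le> \<theta>"
    and Ainf: "\<And>a h E. 0 < h \<Longrightarrow> E \<in> sets lebesgue \<Longrightarrow> E \<subseteq> cube a h \<Longrightarrow>
      emeasure lebesgue E \<le> ennreal (h ^ DIM('a) / 2) \<Longrightarrow>
      emeasure (density lebesgue W) E \<le> ennreal \<theta> * emeasure (density lebesgue W) (cube a h)"
    and t: "0 \<le> t" and C: "0 \<le> C"
    and IH: "\<And>a h. 0 < h \<Longrightarrow>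
      (\<integral>\<^sup>+x\<in>cube a h. W x * ennreal (exp (t * min \<bar>f x - average (cube a h) f\<bar> K)) \<partial>lebesgue)
        \<le> ennreal C * emeasure (density lebesgue W) (cube a h)"
    and h: "0 < h"
  defines "\<kappa> \<equiv> 2 ^ DIM('a) * N"
  shows "(\<integral>\<^sup>+x\<in>cube a h. W x * ennreal (exp (t * min \<bar>f x - average (cube a h) f\<bar> K)) \<partial>lebesgue)
    \<le> ennreal (exp (t * (2 * N + 2 * \<kappa>)) + \<theta> * exp (t * (2 * N + \<kappa>)) * C)
        * emeasure (density lebesgue W) (cube a h)"
proof -
  have f_meas [measurable]: "f \<in> borel_measurable lebesgue"
    using f by (rule locally_integrable_measurable)
  have \<kappa>0: "0 \<le> \<kappa>" using N by (simp add: \<kappa>_def)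
  define c where "c = average (cube a h) f"
  \<comment> \<open>The threshold is twice the bound for the mean oscillation: by Chebyshev's
    inequality the selected cubes fill at most half of the cube, as \<open>Ainf\<close>
    requires.\<close>
  define P where "P b k \<longleftrightarrow> 2 * N < \<bar>average (cube b k) f - c\<bar>" for b k
  define U where "U = (\<Union>n. stop_set P n a h)"
  define V where "V s x = W x * ennreal (exp (t * min \<bar>f x - s\<bar> K))" for s x
  have V [measurable]: "V s \<in> borel_measurable lebesgue" for s
    unfolding V_def by measurable
  let ?\<mu> = "density lebesgue W"
  have nP: "\<not> P a h" using N by (simp add: P_def c_def)
  have small: "emeasure lebesgue (stop_set P n a h) \<le> ennreal (h ^ DIM('a) / 2)" for n
  proof -
    let ?M = "density lebesgue (\<lambda>x. ennreal (2 * N))" and ?M' = "density lebesgue (\<lambda>x. ennreal \<bar>f x - c\<bar>)"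
    have "emeasure ?M (stop_set P n a h) \<le> emeasure ?M' (stop_set P n a h)"
    proof (rule stop_set_measure_le[of _ _ P])
      fix b k S assume *: "0 < k" "P (half_corner b k S) (k / 2)"
      let ?Q = "cube (half_corner b k S) (k / 2)"
      have "emeasure ?M ?Q = ennreal (2 * N * measure lebesgue ?Q)"
        using * N by (simp add: emeasure_density_const emeasure_cube measure_cube ennreal_mult'
            del: emeasure_completion measure_completion)
          (simp add: measure_cube emeasure_cube[simplified] ennreal_mult')
      also have "\<dots> \<le> ennreal (\<bar>average ?Q f - c\<bar> * measure lebesgue ?Q)"
        using * by (intro ennreal_leI mult_right_mono) (auto simp: P_def)
      also have "\<dots> \<le> (\<integral>\<^sup>+x\<in>?Q. ennreal \<bar>f x - c\<bar> \<partial>lebesgue)"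
        using * by (intro average_deviation f bounded_cube) (auto simp: measure_cube)
      also have "\<dots> = emeasure ?M' ?Q" by (simp add: emeasure_density)
      finally show "emeasure ?M ?Q \<le> emeasure ?M' ?Q" .
    qed (use h nP in auto)
    also have "\<dots> \<le> emeasure ?M' (cube a h)"
      using h by (intro emeasure_mono stop_set_subset) auto
    also have "\<dots> \<le> ennreal (N * h ^ DIM('a))"
      using osc h by (simp add: emeasure_density cube_osc_bound_def c_def)
    finally have "ennreal (2 * N) * emeasure lebesgue (stop_set P n a h) \<le> ennreal (2 * N) * ennreal (h ^ DIM('a) / 2)"
      using N h by (simp add: emeasure_density_const ennreal_mult'[symmetric])
    then show ?thesis
      using N by (simp add: ennreal_mult_le_mult_iff)
  qed
  have stop_le: "emeasure (density lebesgue (V c)) (stop_set P n a h)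
      \<le> ennreal (\<theta> * exp (t * (2 * N + \<kappa>)) * C) * emeasure ?\<mu> (cube a h)" for n
  proof -
    let ?E = "exp (t * (2 * N + \<kappa>))"
    let ?M' = "density lebesgue (\<lambda>x. ennreal (?E * C) * W x)"
    have "emeasure (density lebesgue (V c)) (stop_set P n a h) \<le> emeasure ?M' (stop_set P n a h)"
    proof (rule stop_set_measure_le[of _ _ P])
      fix b k S assume *: "0 < k" "\<not> P b k" "S \<subseteq> Basis" "P (half_corner b k S) (k / 2)"
      let ?Q = "cube (half_corner b k S) (k / 2)"
      let ?s = "average ?Q f"
      \<comment> \<open>The parent is not selected, so its average is within \<open>2 * N\<close> of
        c, and passing to the child adds at most \<open>\<kappa>\<close>. Recentring the exponential
        from c to the average of the selected cube thus costs only the factor \<open>?E\<close>,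
        after which \<open>IH\<close> applies there.\<close>
      have "\<bar>?s - average (cube b k) f\<bar> \<le> \<kappa>"
        unfolding \<kappa>_def using * by (intro half_cube_average_diff f osc half_subset_cube)
      then have s: "\<bar>?s - c\<bar> \<le> 2 * N + \<kappa>"
        using * by (simp add: P_def)
      have "V c x \<le> ennreal ?E * V ?s x" for x
      proof -
        \<comment> \<open>For nonnegative a, \<open>min (a + b) K \<le> a + min b K\<close>:
          recentring is compatible with the truncation.\<close>
        have "min \<bar>f x - c\<bar> K \<le> (2 * N + \<kappa>) + min \<bar>f x - ?s\<bar> K"
          using s N \<kappa>0 by linarith
        then have "exp (t * min \<bar>f x - c\<bar> K) \<le> ?E * exp (t * min \<bar>f x - ?s\<bar> K)"
          unfolding exp_add[symmetric] distrib_left[symmetric] using t by (simp add: mult_left_mono)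
        then have "ennreal (exp (t * min \<bar>f x - c\<bar> K)) \<le> ennreal ?E * ennreal (exp (t * min \<bar>f x - ?s\<bar> K))"
          by (simp add: ennreal_mult'[symmetric] ennreal_leI)
        then show ?thesis
          unfolding V_def by (metis mult.left_commute mult_left_mono zero_le)
      qed
      then have "emeasure (density lebesgue (V c)) ?Q \<le> (\<integral>\<^sup>+x. ennreal ?E * (V ?s x * indicator ?Q x) \<partial>lebesgue)"
        by (auto simp: emeasure_density intro!: nn_integral_mono split: split_indicator)
      also have "\<dots> = ennreal ?E * (\<integral>\<^sup>+x\<in>?Q. V ?s x \<partial>lebesgue)"
        by (intro nn_integral_cmult) auto
      also have "\<dots> \<le> ennreal ?E * (ennreal C * emeasure ?\<mu> ?Q)"
        unfolding V_def using * by (intro mult_left_mono IH) auto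
      also have "\<dots> = ennreal (?E * C) * emeasure ?\<mu> ?Q"
        using C by (simp add: ennreal_mult mult.assoc)
      also have "\<dots> = emeasure ?M' ?Q"
        by (simp add: emeasure_density nn_integral_cmult[symmetric] mult.assoc)
      finally show "emeasure (density lebesgue (V c)) ?Q \<le> emeasure ?M' ?Q" .
    qed (use h nP in auto)
    also have "\<dots> = ennreal (?E * C) * emeasure ?\<mu> (stop_set P n a h)"
      by (simp add: emeasure_density nn_integral_cmult[symmetric] mult.assoc)
    \<comment> \<open>The gain of the argument: a stopping set of at most half the volume carries at
      most the fraction \<open>\<theta>\<close> of the weighted mass. This has to outweigh the loss
      \<open>?E\<close>.\<close>
    also have "\<dots> \<le> ennreal (?E * C) * (ennreal \<theta> * emeasure ?\<mu> (cube a h))"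
      using h small by (intro mult_left_mono Ainf stop_set_subset) auto
    also have "\<dots> = ennreal (\<theta> * ?E * C) * emeasure ?\<mu> (cube a h)"
      using C \<theta> by (simp add: ennreal_mult mult_ac)
    finally show ?thesis .
  qed
  have U_sets [measurable]: "U \<in> sets lebesgue" by (auto simp: U_def)
  have U_sub: "U \<subseteq> cube a h" using stop_set_subset[OF h] by (auto simp: U_def)
  have "emeasure (density lebesgue (V c)) U = (SUP n. emeasure (density lebesgue (V c)) (stop_set P n a h))"
    unfolding U_def
    by (intro SUP_emeasure_incseq[symmetric] incseq_SucI stop_set_Suc_mono h) auto
  also have "\<dots> \<le> ennreal (\<theta> * exp (t * (2 * N + \<kappa>)) * C) * emeasure ?\<mu> (cube a h)"
    by (intro SUP_least stop_le)
  finally have inside: "emeasure (density lebesgue (V c)) U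
      \<le> ennreal (\<theta> * exp (t * (2 * N + \<kappa>)) * C) * emeasure ?\<mu> (cube a h)" .
  \<comment> \<open>Outside U unselected dyadic cubes of every generation contain x; their averages
    are within \<open>2 * N\<close> of c, and differentiation transfers this to f with the extra
    \<open>2 * \<kappa>\<close>.\<close>
  have "AE x in lebesgue. x \<in> cube a h - U \<longrightarrow> \<bar>f x - c\<bar> \<le> 2 * N + 2 * \<kappa>"
    using AE_close_to_small_cube_averages[OF f osc]
  proof eventually_elim
    case (elim x)
    show ?case
    proof
      assume x: "x \<in> cube a h - U"
      have "\<exists>b. x \<in> cube b (h / 2 ^ n) \<and> \<bar>average (cube b (h / 2 ^ n)) f - c\<bar> \<le> 2 * N" for n
        using not_stopped_cube[of h P a x n] x h nP by (auto simp: U_def P_def not_less)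
      then show "\<bar>f x - c\<bar> \<le> 2 * N + 2 * \<kappa>" using elim h unfolding \<kappa>_def by blast
    qed
  qed
  then have "AE x in lebesgue. V c x * indicator (cube a h - U) x
      \<le> ennreal (exp (t * (2 * N + 2 * \<kappa>))) * (W x * indicator (cube a h) x)"
  proof eventually_elim
    case (elim x)
    show ?case
    proof (cases "x \<in> cube a h - U")
      case True
      then have "t * min \<bar>f x - c\<bar> K \<le> t * (2 * N + 2 * \<kappa>)"
        using elim t by (intro mult_left_mono) auto
      then show ?thesis
        using True unfolding V_def by (simp add: mult.commute mult_left_mono ennreal_leI)
    qed auto
  qed
  then have "emeasure (density lebesgue (V c)) (cube a h - U)
      \<le> (\<integral>\<^sup>+x. ennreal (exp (t * (2 * N + 2 * \<kappa>))) * (W x * indicator (cube a h) x) \<partial>lebesgue)"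
    by (subst emeasure_density) (auto intro!: nn_integral_mono_AE)
  also have "\<dots> = ennreal (exp (t * (2 * N + 2 * \<kappa>))) * emeasure ?\<mu> (cube a h)"
    by (simp add: emeasure_density nn_integral_cmult)
  finally have outside: "emeasure (density lebesgue (V c)) (cube a h - U)
      \<le> ennreal (exp (t * (2 * N + 2 * \<kappa>))) * emeasure ?\<mu> (cube a h)" .
  have "(\<integral>\<^sup>+x\<in>cube a h. V c x \<partial>lebesgue) = emeasure (density lebesgue (V c)) ((cube a h - U) \<union> U)"
    using U_sub by (simp add: emeasure_density Un_absorb2)
  also have "\<dots> = emeasure (density lebesgue (V c)) (cube a h - U) + emeasure (density lebesgue (V c)) U"
    by (intro plus_emeasure[symmetric]) auto
  also have "\<dots> \<le> ennreal (exp (t * (2 * N + 2 * \<kappa>))) * emeasure ?\<mu> (cube a h)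
      + ennreal (\<theta> * exp (t * (2 * N + \<kappa>)) * C) * emeasure ?\<mu> (cube a h)"
    by (intro add_mono inside outside)
  also have "\<dots> = ennreal (exp (t * (2 * N + 2 * \<kappa>)) + \<theta> * exp (t * (2 * N + \<kappa>)) * C) * emeasure ?\<mu> (cube a h)"
    using \<theta> C by (simp add: distrib_right[symmetric] ennreal_plus[symmetric] del: ennreal_plus)
  finally show ?thesis unfolding V_def c_def .
qed

section \<open>Muckenhoupt weights\<close>

text \<open>The constant is B / (1 - q), the fixed point of the improvement C -> B + q * C. At a
  fixed truncation level K the iteration drives out the starting value \<open>exp (t * K)\<close>;
  only afterwards does K tend to infinity, by Fatou's lemma.\<close>

lemma weighted_John_Nirenberg:
  fixes f :: "'a::euclidean_space \<Rightarrow> real" and W :: "'a \<Rightarrow> ennreal"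
  assumes f: "locally_integrable f" and osc: "cube_osc_bound f N" and N: "0 < N"
    and W [measurable]: "W \<in> borel_measurable lebesgue"
    and fin: "\<And>a h. 0 < h \<Longrightarrow> (\<integral>\<^sup>+x\<in>cube a h. W x \<partial>lebesgue) < \<infinity>"
    and \<theta>: "0 \<le> \<theta>"
    and Ainf: "\<And>a h E. 0 < h \<Longrightarrow> E \<in> sets lebesgue \<Longrightarrow> E \<subseteq> cube a h \<Longrightarrow>
      emeasure lebesgue E \<le> ennreal (h ^ DIM('a) / 2) \<Longrightarrow>
      (\<integral>\<^sup>+x\<in>E. W x \<partial>lebesgue) \<le> ennreal \<theta> * (\<integral>\<^sup>+x\<in>cube a h. W x \<partial>lebesgue)"
    and t: "0 \<le> t" and q: "\<theta> * exp (t * (2 * N + 2 ^ DIM('a) * N)) < 1"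
    and h: "0 < h"
  shows "(\<integral>\<^sup>+x\<in>cube a h. W x * ennreal (exp (t * \<bar>f x - average (cube a h) f\<bar>)) \<partial>lebesgue)
    \<le> ennreal (exp (t * (2 * N + 2 * (2 ^ DIM('a) * N))) / (1 - \<theta> * exp (t * (2 * N + 2 ^ DIM('a) * N))))
        * (\<integral>\<^sup>+x\<in>cube a h. W x \<partial>lebesgue)"
proof -
  have [measurable]: "f \<in> borel_measurable lebesgue"
    using f by (rule locally_integrable_measurable)
  define B where "B = exp (t * (2 * N + 2 * (2 ^ DIM('a) * N)))"
  define q where "q = \<theta> * exp (t * (2 * N + 2 ^ DIM('a) * N))"
  have q01: "0 \<le> q" "q < 1" using \<theta> assms(9) by (auto simp: q_def)
  have B0: "0 \<le> B" by (simp add: B_def)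
  have dens: "emeasure (density lebesgue W) E = (\<integral>\<^sup>+x\<in>E. W x \<partial>lebesgue)" if "E \<in> sets lebesgue" for E
    using that by (simp add: emeasure_density)
  define I where "I K a h = (\<integral>\<^sup>+x\<in>cube a h. W x * ennreal (exp (t * min \<bar>f x - average (cube a h) f\<bar> K)) \<partial>lebesgue)"
    for K a h
  have trunc: "I K a h \<le> ennreal (q ^ n * exp (t * K) + B / (1 - q)) * (\<integral>\<^sup>+x\<in>cube a h. W x \<partial>lebesgue)"
    if "0 < h" for K a h n
    using that
  proof (induction n arbitrary: a h)
    case 0
    have "I K a h \<le> (\<integral>\<^sup>+x. ennreal (exp (t * K) + B / (1 - q)) * (W x * indicator (cube a h) x) \<partial>lebesgue)"
      unfolding I_def
    proof (rule nn_integral_mono)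
      fix x
      have "exp (t * min \<bar>f x - average (cube a h) f\<bar> K) \<le> exp (t * K)"
        using t by (simp add: mult_left_mono)
      also have "\<dots> \<le> exp (t * K) + B / (1 - q)" using B0 q01 by simp
      finally show "W x * ennreal (exp (t * min \<bar>f x - average (cube a h) f\<bar> K)) * indicator (cube a h) x
          \<le> ennreal (exp (t * K) + B / (1 - q)) * (W x * indicator (cube a h) x)"
        by (auto split: split_indicator simp: mult.commute intro!: mult_left_mono ennreal_leI)
    qed
    then show ?case by (simp add: nn_integral_cmult)
  next
    case (Suc n)
    have "I K a h \<le> ennreal (B + q * (q ^ n * exp (t * K) + B / (1 - q))) * (\<integral>\<^sup>+x\<in>cube a h. W x \<partial>lebesgue)"
      unfolding B_def q_def I_def
      by (rule weighted_John_Nirenberg_truncated_step[OF f osc N W \<theta> _ t _ _ Suc.prems, unfolded dens[OF cube_lebesgue]])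
        (use Ainf Suc.IH q01 B0 in \<open>auto simp: dens I_def B_def[symmetric] q_def[symmetric]\<close>)
    also have "B + q * (q ^ n * exp (t * K) + B / (1 - q)) = q ^ Suc n * exp (t * K) + B / (1 - q)"
      using q01 by (simp add: field_simps)
    finally show ?case .
  qed
  obtain w where w: "0 \<le> w" "(\<integral>\<^sup>+x\<in>cube a h. W x \<partial>lebesgue) = ennreal w"
    using fin[OF h, of a] by (cases "\<integral>\<^sup>+x\<in>cube a h. W x \<partial>lebesgue") auto
  have trunc2: "I K a h \<le> ennreal (B / (1 - q) * w)" for K
  proof (rule LIMSEQ_le_const)
    have "(\<lambda>n. (q ^ n * exp (t * K) + B / (1 - q)) * w) \<longlonglongrightarrow> (0 * exp (t * K) + B / (1 - q)) * w"
      using q01 by (intro tendsto_intros LIMSEQ_realpow_zero) auto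
    then show "(\<lambda>n. ennreal ((q ^ n * exp (t * K) + B / (1 - q)) * w)) \<longlonglongrightarrow> ennreal (B / (1 - q) * w)"
      by simp
    show "\<exists>m. \<forall>n\<ge>m. I K a h \<le> ennreal ((q ^ n * exp (t * K) + B / (1 - q)) * w)"
      using trunc[OF h, of K a] w q01 B0 by (auto simp: ennreal_mult)
  qed
  let ?c = "average (cube a h) f"
  have "(\<integral>\<^sup>+x\<in>cube a h. W x * ennreal (exp (t * \<bar>f x - ?c\<bar>)) \<partial>lebesgue)
      = (\<integral>\<^sup>+x. liminf (\<lambda>n. W x * ennreal (exp (t * min \<bar>f x - ?c\<bar> (real n))) * indicator (cube a h) x) \<partial>lebesgue)"
  proof (rule nn_integral_cong)
    fix x
    obtain m :: nat where m: "\<bar>f x - ?c\<bar> \<le> real m" using real_arch_simple by blast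
    have "min \<bar>f x - ?c\<bar> (real n) = \<bar>f x - ?c\<bar>" if "m \<le> n" for n
    proof -
      have "\<bar>f x - ?c\<bar> \<le> real n" using m that by linarith
      then show ?thesis by simp
    qed
    then have "(\<lambda>n. W x * ennreal (exp (t * min \<bar>f x - ?c\<bar> (real n))) * indicator (cube a h) x)
        \<longlonglongrightarrow> W x * ennreal (exp (t * \<bar>f x - ?c\<bar>)) * indicator (cube a h) x"
      by (intro tendsto_eventually) (auto simp: eventually_sequentially intro!: exI[of _ m])
    then show "W x * ennreal (exp (t * \<bar>f x - ?c\<bar>)) * indicator (cube a h) x
        = liminf (\<lambda>n. W x * ennreal (exp (t * min \<bar>f x - ?c\<bar> (real n))) * indicator (cube a h) x)"
      by (simp add: lim_imp_Liminf)
  qed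
  also have "\<dots> \<le> liminf (\<lambda>n. I (real n) a h)"
    unfolding I_def by (rule nn_integral_liminf) measurable
  also have "\<dots> \<le> limsup (\<lambda>n. I (real n) a h)"
    by (rule Liminf_le_Limsup) simp
  also have "\<dots> \<le> ennreal (B / (1 - q) * w)"
    using trunc2 by (intro Limsup_bounded) auto
  also have "\<dots> = ennreal (B / (1 - q)) * ennreal w"
    using B0 q01 w by (intro ennreal_mult) auto
  finally show ?thesis unfolding w B_def q_def .
qed

text \<open>Hoelder's inequality for 1 = w^(1/p) * \<sigma>^(1 - 1/p) with \<sigma> = w^(-1/(p-1)).
  It comes from integrating Young's inequality for the normalised densities w / a and \<sigma> / b,
  whose convex combination has integral 1. Null sets are treated apart, because a and b vanish on
  them.\<close>

lemma Holder_dual_weight: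
  fixes w :: "'a::euclidean_space \<Rightarrow> real"
  assumes p: "1 < p" and [measurable]: "w \<in> borel_measurable lebesgue" "E \<in> sets lebesgue"
    and pos: "AE x in lebesgue. 0 < w x"
    and a: "(\<integral>\<^sup>+x\<in>E. ennreal (w x) \<partial>lebesgue) = ennreal a" "0 \<le> a"
    and b: "(\<integral>\<^sup>+x\<in>E. ennreal (w x powr (- 1 / (p - 1))) \<partial>lebesgue) = ennreal b" "0 \<le> b"
    and m: "emeasure lebesgue E = ennreal m" "0 \<le> m"
  shows "m powr p \<le> a * b powr (p - 1)"
proof (cases "m = 0")
  case False
  have "0 < (\<integral>\<^sup>+x\<in>E. g x \<partial>lebesgue)" if [measurable]: "g \<in> borel_measurable lebesgue" and "AE x in lebesgue. 0 < g x"
    for g :: "'a \<Rightarrow> ennreal"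
  proof (rule ccontr)
    assume "\<not> 0 < (\<integral>\<^sup>+x\<in>E. g x \<partial>lebesgue)"
    then have "AE x in lebesgue. g x * indicator E x = 0"
      by (subst (asm) not_gr_zero, subst (asm) nn_integral_0_iff_AE) auto
    with that(2) have "AE x in lebesgue. x \<notin> E"
      by eventually_elim (auto split: split_indicator_asm)
    then have "emeasure lebesgue E = 0"
      using AE_iff_measurable[of E lebesgue "\<lambda>x. x \<notin> E"] by auto
    then show False using m False by simp
  qed
  note integral_pos = this
  have nz: "AE x in lebesgue. w x \<noteq> 0"
    using pos by eventually_elim simp
  have ab: "0 < a" "0 < b"
    using integral_pos[of "\<lambda>x. ennreal (w x)"]
      integral_pos[of "\<lambda>x. ennreal (w x powr (- 1 / (p - 1)))"] pos nz a b by auto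
  define k where "k = a powr (1 / p) * b powr (1 - 1 / p)"
  have k: "0 < k" using ab by (simp add: k_def)
  have "AE x in lebesgue. ennreal (1 / k) * indicator E x
     \<le> ennreal (1 / (p * a)) * (ennreal (w x) * indicator E x)
       + ennreal ((1 - 1 / p) / b) * (ennreal (w x powr (- 1 / (p - 1))) * indicator E x)"
    using pos
  proof eventually_elim
    case (elim x)
    let ?s = "w x powr (- 1 / (p - 1))"
    have "?s powr (1 - 1 / p) = w x powr (- (1 / p))"
      unfolding powr_powr using p by (intro arg_cong2[where f = "(powr)"]) (auto simp: field_simps)
    then have one: "w x powr (1 / p) * ?s powr (1 - 1 / p) = 1"
      using elim by (simp add: powr_minus)
    have "1 / k = (w x / a) powr (1 / p) * (?s / b) powr (1 - 1 / p)"
      using elim ab one by (simp add: powr_divide k_def field_simps)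
    also have "\<dots> \<le> (1 / p) * (w x / a) + (1 - 1 / p) * (?s / b)"
      using p elim ab by (intro Youngs_inequality_0) auto
    finally have "ennreal (1 / k) \<le> ennreal ((1 / p) * (w x / a) + (1 - 1 / p) * (?s / b))"
      by (rule ennreal_leI)
    also have "\<dots> = ennreal (1 / (p * a)) * ennreal (w x) + ennreal ((1 - 1 / p) / b) * ennreal ?s"
      using p elim ab by (simp add: ennreal_plus[symmetric] ennreal_mult'[symmetric] del: ennreal_plus)
    finally show ?case by (auto split: split_indicator)
  qed
  then have "(\<integral>\<^sup>+x. ennreal (1 / k) * indicator E x \<partial>lebesgue)
     \<le> (\<integral>\<^sup>+x. ennreal (1 / (p * a)) * (ennreal (w x) * indicator E x)
       + ennreal ((1 - 1 / p) / b) * (ennreal (w x powr (- 1 / (p - 1))) * indicator E x) \<partial>lebesgue)"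
    by (rule nn_integral_mono_AE)
  also have "\<dots> = ennreal (1 / (p * a)) * ennreal a + ennreal ((1 - 1 / p) / b) * ennreal b"
    by (simp add: nn_integral_add nn_integral_cmult a(1) b(1)[simplified])
  also have "\<dots> = ennreal 1"
    using p ab by (simp add: ennreal_plus[symmetric] ennreal_mult'[symmetric] del: ennreal_plus)
  finally have "ennreal (1 / k) * ennreal m \<le> ennreal 1"
    using m by (simp add: nn_integral_cmult)
  then have "m / k \<le> 1"
    using k m by (simp add: ennreal_mult'[symmetric])
  then have "m \<le> k" using k by (simp add: field_simps)
  then have "m powr p \<le> k powr p" using m p by (intro powr_mono2) auto
  also have "\<dots> = a * b powr (p - 1)"
    using p ab by (simp add: k_def powr_mult powr_powr left_diff_distrib)
  finally show ?thesis .
qed (use p a in auto)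

text \<open>The Muckenhoupt condition over cubes with the averages multiplied out, hence the p-th
  power of the volume on the right. Real witnesses u and s record that both integrals are finite;
  positivity almost everywhere makes the value 0 of \<open>powr\<close> at 0 harmless.\<close>

definition cube_Ap :: "real \<Rightarrow> real \<Rightarrow> ('a::euclidean_space \<Rightarrow> real) \<Rightarrow> bool" where
  "cube_Ap p A w \<longleftrightarrow> w \<in> borel_measurable lebesgue \<and> (AE x in lebesgue. 0 < w x) \<and>
     (\<forall>a h. 0 < h \<longrightarrow> (\<exists>u s. 0 \<le> u \<and> 0 \<le> s \<and>
        (\<integral>\<^sup>+x\<in>cube a h. ennreal (w x) \<partial>lebesgue) = ennreal u \<and>
        (\<integral>\<^sup>+x\<in>cube a h. ennreal (w x powr (- 1 / (p - 1))) \<partial>lebesgue) = ennreal s \<and>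
        u * s powr (p - 1) \<le> A * (h ^ DIM('a)) powr p))"

text \<open>The complement G of E in the cube has at least half the volume, so Hoelder's inequality
  on G bounds \<open>(V / 2) powr p\<close> by a product of the two masses of G. Enlarging one of
  these masses to that of the whole cube and inserting the Muckenhoupt bound shows that G carries a
  fixed fraction of the other mass; E gets at most the rest.\<close>

lemma cube_Ap_half_measure:
  fixes w :: "'a::euclidean_space \<Rightarrow> real"
  assumes p: "1 < p" and A: "1 \<le> A" and w: "cube_Ap p A w" and h: "0 < h"
    and E [measurable]: "E \<in> sets lebesgue" and sub: "E \<subseteq> cube a h"
    and small: "emeasure lebesgue E \<le> ennreal (h ^ DIM('a) / 2)"
  shows "(\<integral>\<^sup>+x\<in>E. ennreal (w x) \<partial>lebesgue)
      \<le> ennreal (1 - 1 / (2 powr p * A)) * (\<integral>\<^sup>+x\<in>cube a h. ennreal (w x) \<partial>lebesgue)" (is ?th1)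
    and "(\<integral>\<^sup>+x\<in>E. ennreal (w x powr (- 1 / (p - 1))) \<partial>lebesgue)
      \<le> ennreal (1 - 1 / (2 powr p * A) powr (1 / (p - 1)))
        * (\<integral>\<^sup>+x\<in>cube a h. ennreal (w x powr (- 1 / (p - 1))) \<partial>lebesgue)" (is ?th2)
proof -
  have [measurable]: "w \<in> borel_measurable lebesgue" using w by (simp add: cube_Ap_def)
  define \<sigma> where "\<sigma> x = w x powr (- 1 / (p - 1))" for x
  have [measurable]: "\<sigma> \<in> borel_measurable lebesgue" unfolding \<sigma>_def by measurable
  define V where "V = h ^ DIM('a)"
  have V: "0 < V" using h by (simp add: V_def)
  define G where "G = cube a h - E"
  have [measurable]: "G \<in> sets lebesgue" by (simp add: G_def)
  obtain u s where us: "0 \<le> u" "0 \<le> s" "(\<integral>\<^sup>+x\<in>cube a h. ennreal (w x) \<partial>lebesgue) = ennreal u"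
    "(\<integral>\<^sup>+x\<in>cube a h. ennreal (\<sigma> x) \<partial>lebesgue) = ennreal s" "u * s powr (p - 1) \<le> A * V powr p"
    using w h unfolding cube_Ap_def V_def \<sigma>_def by meson
  have split: "(\<integral>\<^sup>+x\<in>E. g x \<partial>lebesgue) + (\<integral>\<^sup>+x\<in>G. g x \<partial>lebesgue) = (\<integral>\<^sup>+x\<in>cube a h. g x \<partial>lebesgue)"
    if [measurable]: "g \<in> borel_measurable lebesgue" for g :: "'a \<Rightarrow> ennreal"
  proof -
    have "(\<integral>\<^sup>+x\<in>E. g x \<partial>lebesgue) + (\<integral>\<^sup>+x\<in>G. g x \<partial>lebesgue) = (\<integral>\<^sup>+x. g x * indicator E x + g x * indicator G x \<partial>lebesgue)"
      by (intro nn_integral_add[symmetric]) auto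
    also have "\<dots> = (\<integral>\<^sup>+x\<in>cube a h. g x \<partial>lebesgue)"
      using sub by (intro nn_integral_cong) (auto simp: G_def split: split_indicator)
    finally show ?thesis .
  qed
  have parts: "\<exists>e g. 0 \<le> e \<and> 0 \<le> g \<and> X = ennreal e \<and> Y = ennreal g \<and> e + g = c"
    if "X + Y = ennreal c" "0 \<le> c" for X Y c
  proof (cases X; cases Y)
    fix e g assume *: "X = ennreal e" "0 \<le> e" "Y = ennreal g" "0 \<le> g"
    then have "ennreal (e + g) = ennreal c" using that by (simp add: ennreal_plus)
    then have "e + g = c" using * that(2) by (subst (asm) ennreal_inj) auto
    then show ?thesis using * by blast
  qed (use that in \<open>auto simp: top_unique\<close>)
  obtain ue ug where u: "0 \<le> ue" "0 \<le> ug" "(\<integral>\<^sup>+x\<in>E. ennreal (w x) \<partial>lebesgue) = ennreal ue"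
    "(\<integral>\<^sup>+x\<in>G. ennreal (w x) \<partial>lebesgue) = ennreal ug" "ue + ug = u"
    using parts[OF split[of "\<lambda>x. ennreal (w x)", unfolded us(3)] us(1)] by auto
  obtain se sg where s: "0 \<le> se" "0 \<le> sg" "(\<integral>\<^sup>+x\<in>E. ennreal (\<sigma> x) \<partial>lebesgue) = ennreal se"
    "(\<integral>\<^sup>+x\<in>G. ennreal (\<sigma> x) \<partial>lebesgue) = ennreal sg" "se + sg = s"
    using parts[OF split[of "\<lambda>x. ennreal (\<sigma> x)", unfolded us(4)] us(2)] by auto
  obtain me mg where m: "0 \<le> me" "0 \<le> mg" "emeasure lebesgue E = ennreal me"
    "emeasure lebesgue G = ennreal mg" "me + mg = V"
  proof -
    have "emeasure lebesgue E + emeasure lebesgue G = ennreal V"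
      using split[of "\<lambda>_. 1"] emeasure_cube[of h a] h by (simp add: V_def)
    from parts[OF this] V that show ?thesis by auto
  qed
  have "me \<le> V / 2" using small m V by (simp add: V_def)
  then have "(V / 2) powr p \<le> mg powr p"
    using V p m by (intro powr_mono2) auto
  also have "\<dots> \<le> ug * sg powr (p - 1)"
    by (rule Holder_dual_weight[OF p _ _ _ u(4,2) s(4)[unfolded \<sigma>_def] s(2) m(4,2)])
      (use w in \<open>auto simp: cube_Ap_def\<close>)
  finally have key: "V powr p \<le> 2 powr p * (ug * sg powr (p - 1))"
    using V by (simp add: powr_divide field_simps)
  have Vp: "0 < V powr p" using V by simp
  have pA: "1 \<le> 2 powr p * A"
    using mult_mono[of 1 "2 powr p" 1 A] A p by (simp add: ge_one_powr_ge_zero)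
  have sg_le: "sg powr (p - 1) \<le> s powr (p - 1)" using s p by (intro powr_mono2) auto
  \<comment> \<open>Multiplying by u, instead of dividing by \<open>s powr (p - 1)\<close>, produces
    the Muckenhoupt product without a discussion of s = 0.\<close>
  have "V powr p * u \<le> 2 powr p * (ug * sg powr (p - 1)) * u"
    using key us by (intro mult_right_mono)
  also have "\<dots> \<le> 2 powr p * (ug * s powr (p - 1)) * u"
    using sg_le us u by (intro mult_right_mono mult_left_mono) auto
  also have "\<dots> = 2 powr p * ug * (u * s powr (p - 1))" by simp
  also have "\<dots> \<le> 2 powr p * ug * (A * V powr p)"
    using us u by (intro mult_left_mono) auto
  also have "\<dots> = V powr p * (2 powr p * A * ug)" by simp
  finally have "u \<le> 2 powr p * A * ug" using Vp by (subst (asm) mult_le_cancel_left_pos) auto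
  then have "u / (2 powr p * A) \<le> ug" using pA by (simp add: field_simps)
  then have "ue \<le> (1 - 1 / (2 powr p * A)) * u" using u(5) by (simp add: algebra_simps)
  then show ?th1 unfolding us u using us pA by (simp add: ennreal_mult[symmetric] ennreal_leI field_simps)
  have "V powr p * s powr (p - 1) \<le> 2 powr p * (ug * sg powr (p - 1)) * s powr (p - 1)"
    using key by (intro mult_right_mono) auto
  also have "\<dots> \<le> 2 powr p * (u * sg powr (p - 1)) * s powr (p - 1)"
    using u by (intro mult_right_mono mult_left_mono) auto
  also have "\<dots> = 2 powr p * sg powr (p - 1) * (u * s powr (p - 1))" by simp
  also have "\<dots> \<le> 2 powr p * sg powr (p - 1) * (A * V powr p)"
    using us by (intro mult_left_mono) auto
  also have "\<dots> = V powr p * (2 powr p * A * sg powr (p - 1))" by simp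
  finally have "s powr (p - 1) \<le> 2 powr p * A * sg powr (p - 1)"
    using Vp by (subst (asm) mult_le_cancel_left_pos) auto
  then have "(s powr (p - 1)) powr (1 / (p - 1)) \<le> (2 powr p * A * sg powr (p - 1)) powr (1 / (p - 1))"
    using p by (intro powr_mono2) auto
  then have "s \<le> (2 powr p * A) powr (1 / (p - 1)) * sg"
    using p pA us s A by (simp add: powr_powr powr_mult)
  moreover have k: "1 \<le> (2 powr p * A) powr (1 / (p - 1))"
    using pA p by (intro ge_one_powr_ge_zero) auto
  ultimately have "s / (2 powr p * A) powr (1 / (p - 1)) \<le> sg"
    using k by (subst pos_divide_le_eq) (auto simp: mult.commute)
  then have "se \<le> (1 - 1 / (2 powr p * A) powr (1 / (p - 1))) * s" using s(5) by (simp add: algebra_simps)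
  moreover have "1 / (2 powr p * A) powr (1 / (p - 1)) \<le> 1" using k by (subst divide_le_eq_1_pos) auto
  ultimately show ?th2
    unfolding \<sigma>_def[symmetric] us s using us by (subst ennreal_mult[symmetric]) (auto intro: ennreal_leI)
qed

section \<open>Balls versus cubes, and the weight constant defined by balls\<close>

lemma cube_subset_ball:
  fixes a :: "'a::euclidean_space" and h :: real
  assumes "0 < h"
  shows "cube a h \<subseteq> ball a (2 * DIM('a) * h)"
proof
  fix y assume y: "y \<in> cube a h"
  have "norm (y - a) \<le> (\<Sum>i\<in>Basis. \<bar>(y - a) \<bullet> i\<bar>)" by (rule norm_le_l1)
  also have "\<dots> \<le> (\<Sum>i\<in>(Basis :: 'a set). h)"
    using y by (intro sum_mono) (auto simp: cube_def inner_simps abs_le_iff)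
  also have "\<dots> = DIM('a) * h" by simp
  \<comment> \<open>The coordinate sum alone gives the radius d * h; doubling it makes the
    inequality strict, as the open ball requires. Hence the factor
    \<open>(2 * DIM('a)) ^ DIM('a)\<close> in later constants.\<close>
  also have "\<dots> < 2 * DIM('a) * h" using assms by simp
  finally show "y \<in> ball a (2 * DIM('a) * h)" by (simp add: dist_norm norm_minus_commute)
qed

lemma ball_subset_cube:
  fixes c :: "'a::euclidean_space"
  shows "ball c r \<subseteq> cube (c - r *\<^sub>R One) (2 * r)"
proof
  fix y assume y: "y \<in> ball c r"
  have "\<bar>(y - c) \<bullet> i\<bar> < r" if "i \<in> Basis" for i
    using Basis_le_norm[OF that, of "y - c"] y by (simp add: dist_norm norm_minus_commute)
  then show "y \<in> cube (c - r *\<^sub>R One) (2 * r)"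
    by (fastforce simp: cube_def inner_simps abs_less_iff)
qed

lemma inverse_ennpow:
  assumes "0 \<le> y"
  shows "inverse (ennpow (ennreal y) a) = (if y = 0 then top else ennreal (y powr (- a)))"
  using assms by (auto simp: ennpow_def inverse_ennreal powr_minus)

lemma Ap_const_term_le:
  "0 < r \<Longrightarrow> nn_average (ball c r) (\<lambda>x. ennreal (v x)) *
      ennpow (nn_average (ball c r) (\<lambda>x. inverse (ennpow (ennreal (v x)) (1 / (p - 1))))) (p - 1)
    \<le> Ap_const p v"
  unfolding Ap_const_def by (rule SUP_upper2[of "(c, r)"]) auto

lemma nn_average_ennreal:
  fixes c :: "'a::euclidean_space"
  assumes "0 < r" "0 \<le> u" "(\<integral>\<^sup>+x\<in>ball c r. g x \<partial>lebesgue) = ennreal u"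
  shows "nn_average (ball c r) g = ennreal (u / measure lebesgue (ball c r))"
proof -
  have "0 < measure lebesgue (ball c r)" using assms by (simp add: content_ball)
  moreover have "emeasure lebesgue (ball c r) = ennreal (measure lebesgue (ball c r))"
    using assms by (simp add: emeasure_ball content_ball)
  ultimately show ?thesis using assms by (simp add: nn_average_def divide_ennreal)
qed

text \<open>The reciprocal in \<open>ennreal\<close> and the real power differ only where the weight
  vanishes, a null set here. Each term of the supremum is thus an ordinary real expression, used
  both to exploit a finite \<open>Ap_const\<close> and to bound a new one.\<close>

lemma Ap_const_term:
  fixes c :: "'a::euclidean_space"
  assumes p: "1 < p" and w: "\<And>x. 0 \<le> w x" "AE x in lebesgue. 0 < w x" and r: "0 < r"
    and u: "0 \<le> u" "(\<integral>\<^sup>+x\<in>ball c r. ennreal (w x) \<partial>lebesgue) = ennreal u"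
    and s: "0 \<le> s" "(\<integral>\<^sup>+x\<in>ball c r. ennreal (w x powr (- 1 / (p - 1))) \<partial>lebesgue) = ennreal s"
  shows "nn_average (ball c r) (\<lambda>x. ennreal (w x)) *
      ennpow (nn_average (ball c r) (\<lambda>x. inverse (ennpow (ennreal (w x)) (1 / (p - 1))))) (p - 1)
    = ennreal (u * s powr (p - 1) / measure lebesgue (ball c r) powr p)"
proof -
  have m: "0 < measure lebesgue (ball c r)" using r by (simp add: content_ball)
  have "(\<integral>\<^sup>+x\<in>ball c r. inverse (ennpow (ennreal (w x)) (1 / (p - 1))) \<partial>lebesgue) = ennreal s"
    unfolding s(2)[symmetric]
    by (rule nn_integral_cong_AE) (use w(2) in \<open>eventually_elim, auto simp: inverse_ennpow\<close>)
  then have "nn_average (ball c r) (\<lambda>x. inverse (ennpow (ennreal (w x)) (1 / (p - 1))))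
      = ennreal (s / measure lebesgue (ball c r))"
    using r s by (intro nn_average_ennreal)
  moreover have "nn_average (ball c r) (\<lambda>x. ennreal (w x)) = ennreal (u / measure lebesgue (ball c r))"
    using r u by (intro nn_average_ennreal)
  moreover have "measure lebesgue (ball c r) * measure lebesgue (ball c r) powr (p - 1) = measure lebesgue (ball c r) powr p"
    using m by (simp add: powr_mult_base)
  ultimately show ?thesis
    using m u s by (simp add: ennpow_def ennreal_mult[symmetric] powr_divide del: measure_completion)
qed

text \<open>A ball with nonzero mass has a finite dual integral, since its term in the supremum
  would otherwise be infinite; this forces w to be nonzero almost everywhere in that ball. As w is
  not almost everywhere zero, some ball has mass, and so have all larger concentric ones, which
  exhaust the space. Afterwards every ball is known to have mass, so every dual integral is
  finite.\<close>

lemma Ap_pos_and_finite: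
  fixes w :: "'a::euclidean_space \<Rightarrow> real"
  assumes p: "1 < p" and w: "w \<in> Ap p"
  shows "AE x in lebesgue. 0 < w x"
    and "0 < r \<Longrightarrow> (\<integral>\<^sup>+x\<in>ball c r. ennreal (w x) \<partial>lebesgue) < \<infinity>"
    and "0 < r \<Longrightarrow> (\<integral>\<^sup>+x\<in>ball c r. ennreal (w x powr (- 1 / (p - 1))) \<partial>lebesgue) < \<infinity>"
proof -
  have w0: "0 \<le> w x" for x using w by (simp add: Ap_def weight_def)
  have loc: "locally_integrable w" using w by (simp add: Ap_def weight_def)
  have [measurable]: "w \<in> borel_measurable lebesgue" using loc by (rule locally_integrable_measurable)
  define g where "g x = inverse (ennpow (ennreal (w x)) (1 / (p - 1)))" for x
  have g_eq: "g x = (if w x = 0 then top else ennreal (w x powr (- 1 / (p - 1))))" for x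
    using w0 by (simp add: g_def inverse_ennpow)
  have [measurable]: "g \<in> borel_measurable lebesgue" unfolding g_eq[abs_def] by measurable
  have [measurable]: "ball c r \<in> sets lebesgue" for c :: 'a and r by simp
  have meas: "(\<lambda>x. ennreal (w x) * indicator (ball c r) x) \<in> borel_measurable lebesgue" for c r
    by measurable
  have wfin: "(\<integral>\<^sup>+x\<in>ball c r. ennreal (w x) \<partial>lebesgue) < \<infinity>" for c r
  proof -
    have "set_integrable lebesgue (ball c r) w" using loc by (intro locally_integrable_bounded) auto
    then have "(\<integral>\<^sup>+x. ennreal (indicator (ball c r) x *\<^sub>R w x) \<partial>lebesgue) < \<infinity>"
      using w0 unfolding set_integrable_def by (subst (asm) integrable_iff_bounded) (auto simp: indicator_def abs_mult)
    also have "(\<integral>\<^sup>+x. ennreal (indicator (ball c r) x *\<^sub>R w x) \<partial>lebesgue) = (\<integral>\<^sup>+x\<in>ball c r. ennreal (w x) \<partial>lebesgue)"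
      by (intro nn_integral_cong) (auto split: split_indicator)
    finally show ?thesis .
  qed
  have gfin: "(\<integral>\<^sup>+x\<in>ball c r. g x \<partial>lebesgue) < \<infinity>"
    if r: "0 < r" and nz: "(\<integral>\<^sup>+x\<in>ball c r. ennreal (w x) \<partial>lebesgue) \<noteq> 0" for c r
  proof (rule ccontr)
    assume "\<not> ?thesis"
    then have top: "(\<integral>\<^sup>+x\<in>ball c r. g x \<partial>lebesgue) = top"
      unfolding infinity_ennreal_def by (simp only: top.not_eq_extremum[symmetric] not_not)
    have "nn_average (ball c r) g = top" "nn_average (ball c r) (\<lambda>x. ennreal (w x)) \<noteq> 0"
      using nz top r by (auto simp: nn_average_def ennreal_divide_eq_top_iff emeasure_ball)
    then have "Ap_const p w = top"
      using Ap_const_term_le[OF r, of c w p] unfolding g_def[abs_def]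
      by (simp add: ennpow_def ennreal_mult_top top_unique)
    then show False using w by (simp add: Ap_def)
  qed
  obtain n0 :: nat where n0: "(\<integral>\<^sup>+x\<in>ball 0 (real n0). ennreal (w x) \<partial>lebesgue) \<noteq> 0"
  proof (rule ccontr)
    assume "\<not> thesis"
    then have "\<forall>n::nat. (\<integral>\<^sup>+x\<in>ball 0 (real n). ennreal (w x) \<partial>lebesgue) = 0" using that by blast
    then have "\<forall>n::nat. AE x in lebesgue. ennreal (w x) * indicator (ball 0 (real n)) x = 0"
      using nn_integral_0_iff_AE[OF meas] by blast
    then have "AE x in lebesgue. \<forall>n::nat. ennreal (w x) * indicator (ball 0 (real n)) x = 0"
      by (subst AE_all_countable)
    then have "AE x in lebesgue. w x = 0"
    proof eventually_elim
      case (elim x)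
      obtain n :: nat where "norm x < real n" using reals_Archimedean2 by blast
      then show ?case using elim[rule_format, of n] w0[of x] by (simp add: ennreal_eq_0_iff)
    qed
    then show False using w by (simp add: Ap_def)
  qed
  have "AE x in lebesgue. x \<in> ball 0 (real n) \<longrightarrow> w x \<noteq> 0" for n :: nat
  proof -
    \<comment> \<open>The radius exceeds both \<open>n0\<close>, so that the ball has mass, and n,
      so that it covers the ball in question.\<close>
    let ?B = "ball (0::'a) (real (Suc (n0 + n)))"
    have "(\<integral>\<^sup>+x\<in>ball 0 (real n0). ennreal (w x) \<partial>lebesgue) \<le> (\<integral>\<^sup>+x\<in>?B. ennreal (w x) \<partial>lebesgue)"
      by (intro nn_integral_mono) (auto split: split_indicator)
    then have "(\<integral>\<^sup>+x\<in>?B. ennreal (w x) \<partial>lebesgue) \<noteq> 0"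
      using n0 by (metis le_zero_eq)
    from gfin[OF _ this] have "(\<integral>\<^sup>+x\<in>?B. g x \<partial>lebesgue) \<noteq> \<infinity>" by auto
    then have "AE x in lebesgue. g x * indicator ?B x \<noteq> \<infinity>"
      by (intro nn_integral_noteq_infinite) auto
    then show ?thesis
      by eventually_elim (auto simp: g_eq)
  qed
  then have "AE x in lebesgue. \<forall>n::nat. x \<in> ball 0 (real n) \<longrightarrow> w x \<noteq> 0"
    by (subst AE_all_countable) blast
  then show pos: "AE x in lebesgue. 0 < w x"
  proof eventually_elim
    case (elim x)
    obtain n :: nat where "norm x < real n" using reals_Archimedean2 by blast
    then show ?case using elim[rule_format, of n] w0[of x] by auto
  qed
  show "(\<integral>\<^sup>+x\<in>ball c r. ennreal (w x) \<partial>lebesgue) < \<infinity>" by (rule wfin)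
  show "(\<integral>\<^sup>+x\<in>ball c r. ennreal (w x powr (- 1 / (p - 1))) \<partial>lebesgue) < \<infinity>" if r: "0 < r"
  proof -
    have "(\<integral>\<^sup>+x\<in>ball c r. ennreal (w x) \<partial>lebesgue) \<noteq> 0"
    proof
      assume "(\<integral>\<^sup>+x\<in>ball c r. ennreal (w x) \<partial>lebesgue) = 0"
      then have "AE x in lebesgue. ennreal (w x) * indicator (ball c r) x = 0"
        using nn_integral_0_iff_AE[OF meas] by blast
      with pos have "AE x in lebesgue. x \<notin> ball c r"
        by eventually_elim (auto split: split_indicator_asm)
      then have "ball c r \<in> null_sets lebesgue"
        by (subst AE_iff_null_sets) (simp_all del: mem_ball)
      then have "emeasure lebesgue (ball c r) = 0" by (rule null_setsD1)
      then show False
        using r unit_ball_vol_pos[of "real DIM('a)"] by (simp add: emeasure_ball)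
    qed
    from gfin[OF r this] have "(\<integral>\<^sup>+x\<in>ball c r. g x \<partial>lebesgue) < \<infinity>" .
    also have "(\<integral>\<^sup>+x\<in>ball c r. g x \<partial>lebesgue) = (\<integral>\<^sup>+x\<in>ball c r. ennreal (w x powr (- 1 / (p - 1))) \<partial>lebesgue)"
      by (rule nn_integral_cong_AE) (use pos in \<open>eventually_elim, auto simp: g_eq\<close>)
    finally show ?thesis .
  qed
qed

lemma Ap_ball_bound:
  fixes w :: "'a::euclidean_space \<Rightarrow> real"
  assumes p: "1 < p" and w: "w \<in> Ap p" and r: "0 < r"
  obtains u s where "0 \<le> u" "0 \<le> s" "(\<integral>\<^sup>+x\<in>ball c r. ennreal (w x) \<partial>lebesgue) = ennreal u"
    "(\<integral>\<^sup>+x\<in>ball c r. ennreal (w x powr (- 1 / (p - 1))) \<partial>lebesgue) = ennreal s"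
    "u * s powr (p - 1) \<le> enn2real (Ap_const p w) * measure lebesgue (ball c r) powr p"
proof -
  note fin = Ap_pos_and_finite[OF p w]
  obtain u where u: "0 \<le> u" "(\<integral>\<^sup>+x\<in>ball c r. ennreal (w x) \<partial>lebesgue) = ennreal u"
    using fin(2)[OF r, of c] by (cases "(\<integral>\<^sup>+x\<in>ball c r. ennreal (w x) \<partial>lebesgue)") auto
  obtain s where s: "0 \<le> s" "(\<integral>\<^sup>+x\<in>ball c r. ennreal (w x powr (- 1 / (p - 1))) \<partial>lebesgue) = ennreal s"
    using fin(3)[OF r, of c] by (cases "(\<integral>\<^sup>+x\<in>ball c r. ennreal (w x powr (- 1 / (p - 1))) \<partial>lebesgue)") auto
  have m: "0 < measure lebesgue (ball c r)" using r by (simp add: content_ball)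
  have "ennreal (u * s powr (p - 1) / measure lebesgue (ball c r) powr p) \<le> Ap_const p w"
    using Ap_const_term_le[OF r, of c w p] Ap_const_term[OF p _ fin(1) r u s] w
    by (simp add: Ap_def weight_def)
  also have "Ap_const p w = ennreal (enn2real (Ap_const p w))"
    using w by (simp add: Ap_def)
  finally have "u * s powr (p - 1) / measure lebesgue (ball c r) powr p \<le> enn2real (Ap_const p w)"
    by (subst (asm) ennreal_le_iff) auto
  then have "u * s powr (p - 1) \<le> enn2real (Ap_const p w) * measure lebesgue (ball c r) powr p"
    using m by (subst (asm) pos_divide_le_eq) auto
  with that u s show ?thesis by blast
qed

text \<open>Hoelder's inequality on the unit ball. It places the weight constants in [1,
  \<infinity>), the range on which F is assumed continuous.\<close>

lemma Ap_const_ge_1: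
  fixes w :: "'a::euclidean_space \<Rightarrow> real"
  assumes p: "1 < p" and w: "w \<in> Ap p"
  shows "1 \<le> enn2real (Ap_const p w)"
proof -
  obtain u s where us: "0 \<le> u" "0 \<le> s" "(\<integral>\<^sup>+x\<in>ball 0 1. ennreal (w x) \<partial>lebesgue) = ennreal u"
    "(\<integral>\<^sup>+x\<in>ball 0 1. ennreal (w x powr (- 1 / (p - 1))) \<partial>lebesgue) = ennreal s"
    "u * s powr (p - 1) \<le> enn2real (Ap_const p w) * measure lebesgue (ball (0::'a) 1) powr p"
    by (rule Ap_ball_bound[OF p w, of 1 0]) auto
  have m: "0 < measure lebesgue (ball (0::'a) 1)" by (simp add: content_ball)
  have "measure lebesgue (ball (0::'a) 1) powr p \<le> u * s powr (p - 1)"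
    by (rule Holder_dual_weight[OF p _ _ Ap_pos_and_finite(1)[OF p w] us(3,1,4,2)])
      (use w in \<open>auto simp: Ap_def weight_def emeasure_ball content_ball intro: locally_integrable_measurable\<close>)
  with us have "1 * measure lebesgue (ball (0::'a) 1) powr p \<le> enn2real (Ap_const p w) * measure lebesgue (ball (0::'a) 1) powr p"
    by linarith
  then show ?thesis using m by (subst (asm) mult_le_cancel_right_pos) auto
qed

text \<open>Both integrals only grow when the cube is replaced by a ball containing it, whose volume
  is a dimensional multiple of \<open>h ^ DIM('a)\<close>; the p-th power of that multiple is the
  loss.\<close>

lemma Ap_imp_cube_Ap:
  fixes w :: "'a::euclidean_space \<Rightarrow> real"
  assumes p: "1 < p" and w: "w \<in> Ap p"
  shows "cube_Ap p (enn2real (Ap_const p w) * (measure lebesgue (ball (0::'a) 1) * (2 * DIM('a)) ^ DIM('a)) powr p) w"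
  unfolding cube_Ap_def
proof (intro conjI allI impI)
  show "w \<in> borel_measurable lebesgue"
    using w by (auto simp: Ap_def weight_def intro: locally_integrable_measurable)
  show "AE x in lebesgue. 0 < w x" by (rule Ap_pos_and_finite(1)[OF p w])
  fix a :: 'a and h :: real assume h: "0 < h"
  let ?r = "2 * DIM('a) * h"
  have r: "0 < ?r" using h by simp
  obtain u s where us: "0 \<le> u" "0 \<le> s" "(\<integral>\<^sup>+x\<in>ball a ?r. ennreal (w x) \<partial>lebesgue) = ennreal u"
    "(\<integral>\<^sup>+x\<in>ball a ?r. ennreal (w x powr (- 1 / (p - 1))) \<partial>lebesgue) = ennreal s"
    "u * s powr (p - 1) \<le> enn2real (Ap_const p w) * measure lebesgue (ball a ?r) powr p"
    by (rule Ap_ball_bound[OF p w r, of a]) auto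
  have sub: "\<exists>v. 0 \<le> v \<and> v \<le> b \<and> (\<integral>\<^sup>+x\<in>cube a h. g x \<partial>lebesgue) = ennreal v"
    if "(\<integral>\<^sup>+x\<in>ball a ?r. g x \<partial>lebesgue) = ennreal b" "0 \<le> b" for g b
  proof -
    have "(\<integral>\<^sup>+x\<in>cube a h. g x \<partial>lebesgue) \<le> ennreal b"
      unfolding that(1)[symmetric] using cube_subset_ball[OF h, of a]
      by (intro nn_integral_mono) (auto split: split_indicator)
    then show ?thesis
      using that(2) by (cases "\<integral>\<^sup>+x\<in>cube a h. g x \<partial>lebesgue") (auto simp: top_unique)
  qed
  obtain u' where u': "0 \<le> u'" "u' \<le> u" "(\<integral>\<^sup>+x\<in>cube a h. ennreal (w x) \<partial>lebesgue) = ennreal u'"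
    using sub[OF us(3,1)] by blast
  obtain s' where s': "0 \<le> s'" "s' \<le> s" "(\<integral>\<^sup>+x\<in>cube a h. ennreal (w x powr (- 1 / (p - 1))) \<partial>lebesgue) = ennreal s'"
    using sub[OF us(4,2)] by blast
  have "u' * s' powr (p - 1) \<le> u * s powr (p - 1)"
    using u' s' us p by (intro mult_mono powr_mono2) auto
  also note us(5)
  also have "measure lebesgue (ball a ?r) powr p
      = (measure lebesgue (ball (0::'a) 1) * (2 * DIM('a)) ^ DIM('a)) powr p * (h ^ DIM('a)) powr p"
    using h r by (simp add: content_ball power_mult_distrib powr_mult[symmetric] mult_ac)
  finally show "\<exists>u s. 0 \<le> u \<and> 0 \<le> s \<and>
        (\<integral>\<^sup>+x\<in>cube a h. ennreal (w x) \<partial>lebesgue) = ennreal u \<and>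
        (\<integral>\<^sup>+x\<in>cube a h. ennreal (w x powr (- 1 / (p - 1))) \<partial>lebesgue) = ennreal s \<and>
        u * s powr (p - 1) \<le> enn2real (Ap_const p w) *
          (measure lebesgue (ball (0::'a) 1) * (2 * DIM('a)) ^ DIM('a)) powr p * (h ^ DIM('a)) powr p"
    using u' s' by (intro exI[of _ u'] exI[of _ s']) (simp add: mult.assoc)
qed

section \<open>Perturbation of weights by exponentials of BMO functions\<close>

lemma cube_osc_bound_mono:
  assumes "cube_osc_bound f N" "N \<le> N'"
  shows "cube_osc_bound f N'"
  unfolding cube_osc_bound_def
proof (intro conjI allI impI)
  show "0 \<le> N'" using assms by (simp add: cube_osc_bound_def)
  fix a :: 'a and h :: real assume h: "0 < h"
  then have "(\<integral>\<^sup>+x\<in>cube a h. ennreal \<bar>f x - average (cube a h) f\<bar> \<partial>lebesgue) \<le> ennreal (N * h ^ DIM('a))"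
    using assms by (simp add: cube_osc_bound_def)
  also have "\<dots> \<le> ennreal (N' * h ^ DIM('a))"
    using assms h by (intro ennreal_leI mult_right_mono) auto
  finally show "(\<integral>\<^sup>+x\<in>cube a h. ennreal \<bar>f x - average (cube a h) f\<bar> \<partial>lebesgue) \<le> ennreal (N' * h ^ DIM('a))" .
qed

lemma cube_Ap_mono:
  assumes "cube_Ap p A w" "A \<le> A'"
  shows "cube_Ap p A' w"
  unfolding cube_Ap_def
proof (intro conjI allI impI)
  show "w \<in> borel_measurable lebesgue" "AE x in lebesgue. 0 < w x"
    using assms by (simp_all add: cube_Ap_def)
  fix a :: 'a and h :: real assume h: "0 < h"
  obtain u s where us: "0 \<le> u" "0 \<le> s"
    "(\<integral>\<^sup>+x\<in>cube a h. ennreal (w x) \<partial>lebesgue) = ennreal u"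
    "(\<integral>\<^sup>+x\<in>cube a h. ennreal (w x powr (- 1 / (p - 1))) \<partial>lebesgue) = ennreal s"
    "u * s powr (p - 1) \<le> A * (h ^ DIM('a)) powr p"
    using assms h unfolding cube_Ap_def by meson
  moreover have "A * (h ^ DIM('a)) powr p \<le> A' * (h ^ DIM('a)) powr p"
    using assms by (intro mult_right_mono) auto
  ultimately show "\<exists>u s. 0 \<le> u \<and> 0 \<le> s \<and>
        (\<integral>\<^sup>+x\<in>cube a h. ennreal (w x) \<partial>lebesgue) = ennreal u \<and>
        (\<integral>\<^sup>+x\<in>cube a h. ennreal (w x powr (- 1 / (p - 1))) \<partial>lebesgue) = ennreal s \<and>
        u * s powr (p - 1) \<le> A' * (h ^ DIM('a)) powr p"
    by (intro exI[of _ u] exI[of _ s]) simp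
qed

text \<open>With b the average over a surrounding ball and c that over the cube, both the integral
  of \<bar>f - b\<bar> over the cube and \<bar>c - b\<bar> times its volume are at most the
  oscillation integral over the ball; hence the leading factor 2.\<close>

lemma BMO_imp_cube_osc_bound:
  fixes f :: "'a::euclidean_space \<Rightarrow> real"
  assumes f: "f \<in> BMO"
  shows "cube_osc_bound f (2 * (enn2real (BMO_norm f) * (measure lebesgue (ball (0::'a) 1) * (2 * DIM('a)) ^ DIM('a))))"
  unfolding cube_osc_bound_def
proof (intro conjI allI impI)
  let ?N = "enn2real (BMO_norm f)" and ?\<beta> = "measure lebesgue (ball (0::'a) 1) * (2 * DIM('a)) ^ DIM('a)"
  have \<beta>: "0 < ?\<beta>" by (simp add: content_ball)
  show "0 \<le> 2 * (?N * ?\<beta>)" using \<beta> by simp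
  have loc: "locally_integrable f" using f by (simp add: BMO_def)
  have [measurable]: "f \<in> borel_measurable lebesgue" using loc by (rule locally_integrable_measurable)
  fix a :: 'a and h :: real assume h: "0 < h"
  let ?r = "2 * DIM('a) * h"
  have r: "0 < ?r" using h by simp
  define B where "B = ball a ?r"
  define b where "b = average B f"
  define c where "c = average (cube a h) f"
  define m where "m = ?\<beta> * h ^ DIM('a)"
  have m: "emeasure lebesgue B = ennreal m" "0 < m"
    using h unit_ball_vol_pos[of "real DIM('a)"]
    by (auto simp: m_def B_def emeasure_ball content_ball power_mult_distrib mult_ac)
  have "nn_average B (\<lambda>x. ennreal \<bar>f x - b\<bar>) \<le> BMO_norm f"
    unfolding BMO_norm_def B_def b_def using r by (intro SUP_upper2[of "(a, ?r)"]) auto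
  also have "BMO_norm f = ennreal ?N" using f by (simp add: BMO_def)
  finally have le: "(\<integral>\<^sup>+x\<in>B. ennreal \<bar>f x - b\<bar> \<partial>lebesgue) / ennreal m \<le> ennreal ?N"
    by (simp add: nn_average_def m del: emeasure_completion)
  have ball_le: "(\<integral>\<^sup>+x\<in>B. ennreal \<bar>f x - b\<bar> \<partial>lebesgue) \<le> ennreal (?N * m)"
  proof (cases "\<integral>\<^sup>+x\<in>B. ennreal \<bar>f x - b\<bar> \<partial>lebesgue")
    case (real i)
    then have "i / m \<le> ?N" using le m by (simp add: divide_ennreal)
    then have "i \<le> ?N * m" using m by (simp add: field_simps)
    then show ?thesis using real by (simp add: ennreal_leI)
  next
    case top
    then show ?thesis using le by (simp add: ennreal_top_divide top_unique)
  qed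
  have Q_le: "(\<integral>\<^sup>+x\<in>cube a h. ennreal \<bar>f x - b\<bar> \<partial>lebesgue) \<le> ennreal (?N * m)"
  proof (rule order_trans[OF _ ball_le])
    show "(\<integral>\<^sup>+x\<in>cube a h. ennreal \<bar>f x - b\<bar> \<partial>lebesgue) \<le> (\<integral>\<^sup>+x\<in>B. ennreal \<bar>f x - b\<bar> \<partial>lebesgue)"
      unfolding B_def using cube_subset_ball[OF h, of a]
      by (intro nn_integral_mono) (auto split: split_indicator)
  qed
  have "ennreal (\<bar>c - b\<bar> * h ^ DIM('a)) \<le> (\<integral>\<^sup>+x\<in>cube a h. ennreal \<bar>f x - b\<bar> \<partial>lebesgue)"
    using average_deviation[OF loc bounded_cube cube_lebesgue, of a h b] h by (simp add: measure_cube c_def)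
  from this Q_le have dev: "ennreal (\<bar>c - b\<bar> * h ^ DIM('a)) \<le> ennreal (?N * m)" by (rule order_trans)
  have "(\<integral>\<^sup>+x\<in>cube a h. ennreal \<bar>f x - c\<bar> \<partial>lebesgue)
      \<le> (\<integral>\<^sup>+x. ennreal \<bar>f x - b\<bar> * indicator (cube a h) x + ennreal \<bar>c - b\<bar> * indicator (cube a h) x \<partial>lebesgue)"
  proof (rule nn_integral_mono)
    fix x
    have "ennreal \<bar>f x - c\<bar> \<le> ennreal (\<bar>f x - b\<bar> + \<bar>c - b\<bar>)" by (rule ennreal_leI) linarith
    then show "ennreal \<bar>f x - c\<bar> * indicator (cube a h) x
        \<le> ennreal \<bar>f x - b\<bar> * indicator (cube a h) x + ennreal \<bar>c - b\<bar> * indicator (cube a h) x"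
      by (auto split: split_indicator)
  qed
  also have "\<dots> = (\<integral>\<^sup>+x\<in>cube a h. ennreal \<bar>f x - b\<bar> \<partial>lebesgue) + ennreal \<bar>c - b\<bar> * emeasure lebesgue (cube a h)"
    by (subst nn_integral_add) (auto simp: nn_integral_cmult_indicator simp del: emeasure_completion)
  also have "ennreal \<bar>c - b\<bar> * emeasure lebesgue (cube a h) = ennreal (\<bar>c - b\<bar> * h ^ DIM('a))"
    using h by (simp add: emeasure_cube ennreal_mult del: emeasure_completion)
  also have "(\<integral>\<^sup>+x\<in>cube a h. ennreal \<bar>f x - b\<bar> \<partial>lebesgue) + ennreal (\<bar>c - b\<bar> * h ^ DIM('a))
      \<le> ennreal (?N * m) + ennreal (?N * m)"
    by (intro add_mono Q_le dev)
  also have "\<dots> = ennreal (2 * (?N * m))"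
    using m(2) by (subst ennreal_plus[symmetric]) auto
  also have "2 * (?N * m) = 2 * (?N * ?\<beta>) * h ^ DIM('a)" by (simp add: m_def)
  finally show "(\<integral>\<^sup>+x\<in>cube a h. ennreal \<bar>f x - average (cube a h) f\<bar> \<partial>lebesgue)
      \<le> ennreal (2 * (?N * ?\<beta>) * h ^ DIM('a))" unfolding c_def .
qed

text \<open>Combines the passage from a ball B to a cube Q with a pointwise bound of the integrand.
  In the application E is an exponential in the cube average of f and K the John-Nirenberg
  constant.\<close>

lemma nn_integral_subset_bound:
  assumes "B \<subseteq> Q" "\<And>x. 0 \<le> k x" "(\<integral>\<^sup>+x\<in>Q. ennreal (k x) \<partial>M) \<le> ennreal K * ennreal u" "0 \<le> u" "0 \<le> K" "0 \<le> E"
    "\<And>x. g x \<le> E * k x" "k \<in> borel_measurable M" "Q \<in> sets M"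
  obtains v where "0 \<le> v" "v \<le> E * K * u" "(\<integral>\<^sup>+x\<in>B. ennreal (g x) \<partial>M) = ennreal v"
proof -
  have "(\<integral>\<^sup>+x\<in>B. ennreal (g x) \<partial>M) \<le> (\<integral>\<^sup>+x. ennreal E * (ennreal (k x) * indicator Q x) \<partial>M)"
  proof (rule nn_integral_mono)
    fix x
    have "ennreal (g x) \<le> ennreal E * ennreal (k x)"
      using assms by (subst ennreal_mult[symmetric]) (auto intro: ennreal_leI)
    then show "ennreal (g x) * indicator B x \<le> ennreal E * (ennreal (k x) * indicator Q x)"
      using assms(1) by (auto split: split_indicator)
  qed
  also have "\<dots> = ennreal E * (\<integral>\<^sup>+x\<in>Q. ennreal (k x) \<partial>M)"
    using assms(8,9) by (intro nn_integral_cmult) auto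
  also have "\<dots> \<le> ennreal E * (ennreal K * ennreal u)"
    by (intro mult_left_mono assms) auto
  also have "\<dots> = ennreal (E * K * u)" using assms by (simp add: ennreal_mult mult.assoc)
  finally have le: "(\<integral>\<^sup>+x\<in>B. ennreal (g x) \<partial>M) \<le> ennreal (E * K * u)" .
  show ?thesis
  proof (cases "\<integral>\<^sup>+x\<in>B. ennreal (g x) \<partial>M")
    case (real v)
    moreover from this le have "v \<le> E * K * u" using assms by (simp add: ennreal_le_iff)
    ultimately show ?thesis using that by blast
  next
    case top
    then show ?thesis using le by (simp add: top_unique)
  qed
qed

text \<open>R and M are chosen before w and f. This uniformity confines the constants of all
  perturbed weights to a bounded interval, on which F is bounded.\<close>

theorem exp_BMO_perturbation_Ap:
  fixes p A N :: real
  assumes p: "1 < p"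
  shows "\<exists>R>0. \<exists>M. \<forall>(w :: 'a::euclidean_space \<Rightarrow> real) f. w \<in> Ap p \<longrightarrow> enn2real (Ap_const p w) = A \<longrightarrow>
     f \<in> BMO \<longrightarrow> enn2real (BMO_norm f) = N \<longrightarrow> (\<forall>x. \<bar>x\<bar> \<le> R \<longrightarrow>
       (\<lambda>y. w y * exp (x * f y)) \<in> Ap p \<and> enn2real (Ap_const p (\<lambda>y. w y * exp (x * f y))) \<le> M)"
proof -
  define \<gamma> where "\<gamma> = measure lebesgue (ball (0::'a) 1)"
  define \<beta> where "\<beta> = \<gamma> * (2 * DIM('a)) ^ DIM('a)"
  have \<gamma>: "0 < \<gamma>" by (simp add: \<gamma>_def content_ball)
  have \<beta>: "0 < \<beta>" using \<gamma> by (simp add: \<beta>_def)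
  have vol_nz: "unit_ball_vol (real DIM('a)) \<noteq> 0"
    using unit_ball_vol_pos[of "real DIM('a)"] by (metis less_irrefl of_nat_0_le_iff)
  \<comment> \<open>Adding 1 keeps the oscillation bound positive even for constant f, as the
    stopping threshold requires; the absolute value is there because N is still an arbitrary real
    number.\<close>
  define N' where "N' = 2 * (\<bar>N\<bar> * \<beta>) + 1"
  define A' where "A' = max 1 (A * \<beta> powr p)"
  define \<kappa> where "\<kappa> = 2 ^ DIM('a) * N'"
  have N': "0 < N'" using \<beta> by (simp add: N'_def add_nonneg_pos)
  have \<kappa>: "0 < \<kappa>" using N' by (simp add: \<kappa>_def)
  have A': "1 \<le> A'" by (simp add: A'_def)
  have pA: "1 \<le> 2 powr p * A'"
    using mult_mono[of 1 "2 powr p" 1 A'] A' p by (simp add: ge_one_powr_ge_zero)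
  then have pA2: "1 \<le> (2 powr p * A') powr (1 / (p - 1))"
    using p by (intro ge_one_powr_ge_zero) auto
  \<comment> \<open>The larger of the fractions for w and for its dual weight, so that a single t
    serves both.\<close>
  define \<theta> where "\<theta> = max (1 - 1 / (2 powr p * A')) (1 - 1 / (2 powr p * A') powr (1 / (p - 1)))"
  have \<theta>: "0 \<le> \<theta>" "\<theta> < 1" using pA pA2 by (auto simp: \<theta>_def le_max_iff_disj)
  define L where "L = 2 * N' + \<kappa>"
  have L: "0 < L" using N' \<kappa> by (simp add: L_def)
  \<comment> \<open>Chosen so that \<open>exp (t * L) = 2 / (1 + \<theta>)\<close>; then
    \<open>\<theta> * exp (t * L)\<close> equals 2\<theta> / (1 + \<theta>) < 1, the contraction
    condition.\<close>
  define t where "t = ln (2 / (1 + \<theta>)) / L"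
  have t: "0 < t" using \<theta> L by (simp add: t_def)
  have tL: "exp (t * L) = 2 / (1 + \<theta>)" using L \<theta> by (simp add: t_def)
  have q: "\<theta> * exp (t * L) < 1" unfolding tL using \<theta> by (simp add: field_simps)
  define K where "K = exp (t * (2 * N' + 2 * \<kappa>)) / (1 - \<theta> * exp (t * L))"
  have K: "0 \<le> K" using q by (simp add: K_def)
  \<comment> \<open>The exponent of f is x in the weight and - x / (p - 1) in its dual; both must be
    at most t in absolute value.\<close>
  define R where "R = min t (t * (p - 1))"
  have R: "0 < R" using t p by (simp add: R_def)
  \<comment> \<open>K from the weight and K^(p-1) from the dual weight combine to K^p. The last
    factor converts the volume of a cube of side 2r into that of the inscribed ball.\<close>
  define M where "M = K powr p * A' * (2 ^ DIM('a) / \<gamma>) powr p"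
  have M0: "0 \<le> M" using A' by (simp add: M_def)
  have main: "(\<lambda>y. w y * exp (x * f y)) \<in> Ap p \<and> enn2real (Ap_const p (\<lambda>y. w y * exp (x * f y))) \<le> M"
    if w: "w \<in> Ap p" and wA: "enn2real (Ap_const p w) = A" and f: "f \<in> BMO" and fN: "enn2real (BMO_norm f) = N"
      and x: "\<bar>x\<bar> \<le> R" for w f :: "'a \<Rightarrow> real" and x
  proof -
    have loc: "locally_integrable f" using f by (simp add: BMO_def)
    have [measurable]: "f \<in> borel_measurable lebesgue" using loc by (rule locally_integrable_measurable)
    have w0: "0 \<le> w y" for y using w by (simp add: Ap_def weight_def)
    have [measurable]: "w \<in> borel_measurable lebesgue"
      using w by (auto simp: Ap_def weight_def intro: locally_integrable_measurable)
    have pos: "AE y in lebesgue. 0 < w y" by (rule Ap_pos_and_finite(1)[OF p w])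
    have "2 * (N * \<beta>) \<le> N'"
      unfolding N'_def using mult_right_mono[of N "\<bar>N\<bar>" \<beta>] \<beta> by linarith
    then have osc: "cube_osc_bound f N'"
      unfolding \<beta>_def \<gamma>_def fN[symmetric] by (rule cube_osc_bound_mono[OF BMO_imp_cube_osc_bound[OF f]])
    have cAp: "cube_Ap p A' w"
      by (rule cube_Ap_mono[OF Ap_imp_cube_Ap[OF p w]]) (simp add: A'_def \<beta>_def \<gamma>_def wA)
    define \<sigma> where "\<sigma> y = w y powr (- 1 / (p - 1))" for y
    have [measurable]: "\<sigma> \<in> borel_measurable lebesgue" unfolding \<sigma>_def by measurable
    have \<sigma>0: "0 \<le> \<sigma> y" for y by (simp add: \<sigma>_def)
    have JN: "(\<integral>\<^sup>+y\<in>cube a h. ennreal (g y * exp (t * \<bar>f y - average (cube a h) f\<bar>)) \<partial>lebesgue)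
        \<le> ennreal K * (\<integral>\<^sup>+y\<in>cube a h. ennreal (g y) \<partial>lebesgue)"
      if g [measurable]: "g \<in> borel_measurable lebesgue" and g0: "\<And>y. 0 \<le> g y"
        and fin: "\<And>a h. 0 < h \<Longrightarrow> (\<integral>\<^sup>+y\<in>cube a h. ennreal (g y) \<partial>lebesgue) < \<infinity>"
        and Ainf: "\<And>a h E. 0 < h \<Longrightarrow> E \<in> sets lebesgue \<Longrightarrow> E \<subseteq> cube a h \<Longrightarrow>
          emeasure lebesgue E \<le> ennreal (h ^ DIM('a) / 2) \<Longrightarrow>
          (\<integral>\<^sup>+y\<in>E. ennreal (g y) \<partial>lebesgue) \<le> ennreal \<theta> * (\<integral>\<^sup>+y\<in>cube a h. ennreal (g y) \<partial>lebesgue)"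
        and h: "0 < h" for g :: "'a \<Rightarrow> real" and a h
    proof -
      have "(\<integral>\<^sup>+y\<in>cube a h. ennreal (g y) * ennreal (exp (t * \<bar>f y - average (cube a h) f\<bar>)) \<partial>lebesgue)
        \<le> ennreal K * (\<integral>\<^sup>+y\<in>cube a h. ennreal (g y) \<partial>lebesgue)"
        unfolding K_def L_def \<kappa>_def
        by (rule weighted_John_Nirenberg[OF loc osc N' _ fin \<theta>(1) Ainf])
          (use t q h in \<open>auto simp: L_def \<kappa>_def\<close>)
      then show ?thesis using g0 by (simp add: ennreal_mult)
    qed
    have fin_w: "(\<integral>\<^sup>+y\<in>cube a h. ennreal (w y) \<partial>lebesgue) < \<infinity>"
      and fin_\<sigma>: "(\<integral>\<^sup>+y\<in>cube a h. ennreal (\<sigma> y) \<partial>lebesgue) < \<infinity>" if "0 < h" for a h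
      using cAp[unfolded cube_Ap_def] that unfolding \<sigma>_def by (metis ennreal_less_top infinity_ennreal_def)+
    have Ainf_w: "(\<integral>\<^sup>+y\<in>E. ennreal (w y) \<partial>lebesgue) \<le> ennreal \<theta> * (\<integral>\<^sup>+y\<in>cube a h. ennreal (w y) \<partial>lebesgue)"
      and Ainf_\<sigma>: "(\<integral>\<^sup>+y\<in>E. ennreal (\<sigma> y) \<partial>lebesgue) \<le> ennreal \<theta> * (\<integral>\<^sup>+y\<in>cube a h. ennreal (\<sigma> y) \<partial>lebesgue)"
      if E: "0 < h" "E \<in> sets lebesgue" "E \<subseteq> cube a h" "emeasure lebesgue E \<le> ennreal (h ^ DIM('a) / 2)" for a h E
      unfolding \<sigma>_def
      by (rule order_trans[OF cube_Ap_half_measure(1)[OF p A' cAp E]]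
               order_trans[OF cube_Ap_half_measure(2)[OF p A' cAp E]];
          intro mult_right_mono ennreal_leI; simp add: \<theta>_def)+
    define v where "v = (\<lambda>y. w y * exp (x * f y))"
    have v0: "0 \<le> v y" for y using w0 by (simp add: v_def)
    have [measurable]: "v \<in> borel_measurable lebesgue" unfolding v_def by measurable
    have vpos: "AE y in lebesgue. 0 < v y" using pos by eventually_elim (simp add: v_def)
    have ball: "\<exists>u s. 0 \<le> u \<and> 0 \<le> s \<and> (\<integral>\<^sup>+y\<in>ball c r. ennreal (v y) \<partial>lebesgue) = ennreal u \<and>
        (\<integral>\<^sup>+y\<in>ball c r. ennreal (v y powr (- 1 / (p - 1))) \<partial>lebesgue) = ennreal s \<and>
        u * s powr (p - 1) \<le> M * measure lebesgue (ball c r) powr p" if r: "0 < r" for c r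
    proof -
      define a where "a = c - r *\<^sub>R One"
      define h where "h = 2 * r"
      have h: "0 < h" using r by (simp add: h_def)
      have sub: "ball c r \<subseteq> cube a h" unfolding a_def h_def by (rule ball_subset_cube)
      let ?F = "average (cube a h) f"
      obtain u s where us: "0 \<le> u" "0 \<le> s"
        "(\<integral>\<^sup>+y\<in>cube a h. ennreal (w y) \<partial>lebesgue) = ennreal u"
        "(\<integral>\<^sup>+y\<in>cube a h. ennreal (\<sigma> y) \<partial>lebesgue) = ennreal s"
        "u * s powr (p - 1) \<le> A' * (h ^ DIM('a)) powr p"
        using cAp h unfolding cube_Ap_def \<sigma>_def by meson
      have ub: "v y \<le> exp (x * ?F) * (w y * exp (t * \<bar>f y - ?F\<bar>))" for y
      proof -
        have "x * (f y - ?F) \<le> \<bar>x\<bar> * \<bar>f y - ?F\<bar>" by (metis abs_ge_self abs_mult)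
        also have "\<dots> \<le> t * \<bar>f y - ?F\<bar>" using x by (intro mult_right_mono) (auto simp: R_def)
        finally have "x * f y \<le> x * ?F + t * \<bar>f y - ?F\<bar>" by (simp add: algebra_simps)
        then have "exp (x * f y) \<le> exp (x * ?F) * exp (t * \<bar>f y - ?F\<bar>)" by (simp add: exp_add[symmetric])
        then show ?thesis using mult_left_mono[OF _ w0[of y]] by (fastforce simp: v_def mult_ac)
      qed
      have sb: "v y powr (- 1 / (p - 1)) \<le> exp (- x * ?F / (p - 1)) * (\<sigma> y * exp (t * \<bar>f y - ?F\<bar>))" for y
      proof -
        have "- x / (p - 1) * (f y - ?F) \<le> \<bar>- x / (p - 1)\<bar> * \<bar>f y - ?F\<bar>" by (metis abs_ge_self abs_mult)
        also have "\<dots> \<le> t * \<bar>f y - ?F\<bar>"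
          using x p by (intro mult_right_mono) (auto simp: R_def field_simps)
        finally have le: "- x * f y / (p - 1) \<le> - x * ?F / (p - 1) + t * \<bar>f y - ?F\<bar>"
          by (simp add: algebra_simps diff_divide_distrib)
        have "exp (x * f y) powr (- 1 / (p - 1)) = exp (- x * f y / (p - 1))"
          by (simp add: powr_def mult_ac)
        also have "\<dots> \<le> exp (- x * ?F / (p - 1)) * exp (t * \<bar>f y - ?F\<bar>)"
          unfolding exp_add[symmetric] exp_le_cancel_iff by (rule le)
        finally have "\<sigma> y * exp (x * f y) powr (- 1 / (p - 1))
            \<le> \<sigma> y * (exp (- x * ?F / (p - 1)) * exp (t * \<bar>f y - ?F\<bar>))"
          using \<sigma>0 by (intro mult_left_mono) auto
        then show ?thesis using w0[of y] by (simp add: v_def powr_mult \<sigma>_def mult_ac)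
      qed
      obtain u' where u': "0 \<le> u'" "u' \<le> exp (x * ?F) * K * u" "(\<integral>\<^sup>+y\<in>ball c r. ennreal (v y) \<partial>lebesgue) = ennreal u'"
        by (rule nn_integral_subset_bound[OF sub _ JN[OF _ w0 fin_w Ainf_w h, of a, unfolded us(3)] us(1) K _ ub])
          (use w0 in auto)
      obtain s' where s': "0 \<le> s'" "s' \<le> exp (- x * ?F / (p - 1)) * K * s"
        "(\<integral>\<^sup>+y\<in>ball c r. ennreal (v y powr (- 1 / (p - 1))) \<partial>lebesgue) = ennreal s'"
        by (rule nn_integral_subset_bound[OF sub _ JN[OF _ \<sigma>0 fin_\<sigma> Ainf_\<sigma> h, of a, unfolded us(4)] us(2) K _ sb])
          (use \<sigma>0 in auto)
      have "u' * s' powr (p - 1) \<le> (exp (x * ?F) * K * u) * (exp (- x * ?F / (p - 1)) * K * s) powr (p - 1)"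
        using u' s' p K us by (intro mult_mono powr_mono2) auto
      \<comment> \<open>The power p - 1 makes the dual factor the reciprocal of
        \<open>exp (x * ?F)\<close>. The cancellation is essential, since no bound on
        \<open>?F\<close> uniform over cubes is available.\<close>
      also have "(exp (- x * ?F / (p - 1)) * K * s) powr (p - 1) = exp (- (x * ?F)) * K powr (p - 1) * s powr (p - 1)"
        using p K us by (simp add: powr_mult) (simp add: powr_def)
      also have "(exp (x * ?F) * K * u) * (exp (- (x * ?F)) * K powr (p - 1) * s powr (p - 1))
          = (exp (x * ?F) * exp (- (x * ?F))) * (K * K powr (p - 1)) * (u * s powr (p - 1))"
        by (simp only: mult_ac)
      also have "\<dots> = K powr p * (u * s powr (p - 1))"
        using K p by (simp add: exp_minus powr_mult_base)
      also have "\<dots> \<le> K powr p * (A' * (h ^ DIM('a)) powr p)"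
        using us by (intro mult_left_mono) auto
      also have "h ^ DIM('a) = 2 ^ DIM('a) / \<gamma> * measure lebesgue (ball c r)"
        using r vol_nz
        by (simp add: h_def \<gamma>_def content_ball power_mult_distrib)
      also have "\<dots> powr p = (2 ^ DIM('a) / \<gamma>) powr p * measure lebesgue (ball c r) powr p"
        by (rule powr_mult)
      finally show ?thesis
        using u' s' by (intro exI[of _ u'] exI[of _ s']) (simp add: M_def mult_ac)
    qed
    have "locally_integrable v"
      unfolding locally_integrable_def
    proof (intro allI impI)
      fix C :: "'a set" assume C: "compact C"
      then obtain r where r: "0 < r" "C \<subseteq> ball 0 r"
        using bounded_subset_ballD[OF compact_imp_bounded, of C 0] by blast
      obtain u where "0 \<le> u" "(\<integral>\<^sup>+y\<in>ball 0 r. ennreal (v y) \<partial>lebesgue) = ennreal u"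
        using ball[OF r(1), of 0] by blast
      moreover have "(\<integral>\<^sup>+y\<in>ball 0 r. ennreal (v y) \<partial>lebesgue)
          = (\<integral>\<^sup>+y. ennreal (norm (indicator (ball 0 r) y *\<^sub>R v y)) \<partial>lebesgue)"
        using v0 by (intro nn_integral_cong) (auto split: split_indicator)
      moreover have "(\<lambda>y. indicator (ball 0 r) y *\<^sub>R v y) \<in> borel_measurable lebesgue"
        by (intro borel_measurable_scaleR borel_measurable_indicator) auto
      ultimately have "set_integrable lebesgue (ball 0 r) v"
        unfolding set_integrable_def by (intro integrableI_bounded) auto
      then show "v absolutely_integrable_on C"
        by (rule set_integrable_subset) (use C r in \<open>auto simp: borel_compact\<close>)
    qed
    moreover have "\<not> (AE y in lebesgue. v y = 0)"
    proof
      assume "AE y in lebesgue. v y = 0"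
      with vpos have "AE y in lebesgue. y \<notin> ball (0::'a) 1" by eventually_elim simp
      then have "ball (0::'a) 1 \<in> null_sets lebesgue"
        by (subst AE_iff_null_sets) (simp_all del: mem_ball)
      then have "emeasure lebesgue (ball (0::'a) 1) = 0" by (rule null_setsD1)
      then show False using unit_ball_vol_pos[of "real DIM('a)"] by (simp add: emeasure_ball)
    qed
    moreover have Mle: "Ap_const p v \<le> ennreal M"
      unfolding Ap_const_def
    proof (rule SUP_least, clarify)
      fix c :: 'a and r :: real assume r: "0 < r"
      obtain u s where us: "0 \<le> u" "0 \<le> s" "(\<integral>\<^sup>+y\<in>ball c r. ennreal (v y) \<partial>lebesgue) = ennreal u"
        "(\<integral>\<^sup>+y\<in>ball c r. ennreal (v y powr (- 1 / (p - 1))) \<partial>lebesgue) = ennreal s"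
        "u * s powr (p - 1) \<le> M * measure lebesgue (ball c r) powr p"
        using ball[OF r, of c] by blast
      have "0 < measure lebesgue (ball c r)" using r by (simp add: content_ball)
      then have "u * s powr (p - 1) / measure lebesgue (ball c r) powr p \<le> M"
        using us(5) by (subst pos_divide_le_eq) auto
      then show "nn_average (ball c r) (\<lambda>x. ennreal (v x)) *
          ennpow (nn_average (ball c r) (\<lambda>x. inverse (ennpow (ennreal (v x)) (1 / (p - 1))))) (p - 1) \<le> ennreal M"
        unfolding Ap_const_term[OF p v0 vpos r us(1,3,2,4)] by (rule ennreal_leI)
    qed
    moreover have "Ap_const p v < top" using Mle by (rule le_less_trans) simp
    ultimately show ?thesis
      using v0 M0 enn2real_mono[OF Mle] unfolding v_def[symmetric] by (auto simp: Ap_def weight_def)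
  qed
  show ?thesis
    by (rule exI[of _ R], rule conjI[OF R], rule exI[of _ M], intro allI impI, rule main)
qed

section \<open>Norm estimates in Lp\<close>

text \<open>Membership is kept together with the bound because \<open>Lp_norm\<close> gives 0 when
  the p-th power of the modulus is not integrable, the Bochner integral being 0 by default.\<close>

definition Lp_le :: "'a measure \<Rightarrow> real \<Rightarrow> ('a \<Rightarrow> complex) \<Rightarrow> real \<Rightarrow> bool" where
  "Lp_le M p u B \<longleftrightarrow> u \<in> Lp M p \<and> Lp_norm M p u \<le> B"

lemma Lp_norm_nonneg [simp]: "0 \<le> Lp_norm M p u"
  by (simp add: Lp_norm_def)

lemma Lp_le_refl: "u \<in> Lp M p \<Longrightarrow> Lp_le M p u (Lp_norm M p u)"
  by (simp add: Lp_le_def)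

lemma Lp_le_nonneg: "Lp_le M p u B \<Longrightarrow> 0 \<le> B"
  unfolding Lp_le_def using Lp_norm_nonneg order_trans by blast

lemma Lp_le_weaken: "Lp_le M p u B \<Longrightarrow> B \<le> B' \<Longrightarrow> Lp_le M p u B'"
  by (simp add: Lp_le_def)

lemma Lp_le_measurable: "Lp_le M p u B \<Longrightarrow> u \<in> borel_measurable M"
  by (simp add: Lp_le_def Lp_def)

lemma Lp_norm_powr: "1 < p \<Longrightarrow> Lp_norm M p u powr p = (LINT x|M. norm (u x) powr p)"
  by (simp add: Lp_norm_def powr_powr)

lemma Lp_le_iff:
  assumes "1 < p" "0 \<le> B"
  shows "Lp_le M p u B \<longleftrightarrow> u \<in> borel_measurable M \<and> integrable M (\<lambda>x. norm (u x) powr p)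
    \<and> (LINT x|M. norm (u x) powr p) \<le> B powr p"
proof -
  have "Lp_norm M p u \<le> B \<longleftrightarrow> Lp_norm M p u powr p \<le> B powr p"
  proof
    show "Lp_norm M p u \<le> B" if "Lp_norm M p u powr p \<le> B powr p"
    proof (rule ccontr)
      assume "\<not> Lp_norm M p u \<le> B"
      then have "B powr p < Lp_norm M p u powr p" using assms by (intro powr_less_mono2) auto
      then show False using that by simp
    qed
  qed (use assms in \<open>auto intro: powr_mono2\<close>)
  then show ?thesis
    using assms by (simp add: Lp_le_def Lp_def Lp_norm_powr)
qed

lemma Lp_le_dominated:
  assumes p: "1 < p" and v: "Lp_le M p v B" and u: "u \<in> borel_measurable M" and c: "0 \<le> c"
    and le: "AE x in M. norm (u x) \<le> c * norm (v x)"
  shows "Lp_le M p u (c * B)"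
proof -
  have B: "0 \<le> B" using v by (rule Lp_le_nonneg)
  have vi: "integrable M (\<lambda>x. c powr p * norm (v x) powr p)" "(LINT x|M. norm (v x) powr p) \<le> B powr p"
    using v Lp_le_iff[OF p B] by auto
  have AE: "AE x in M. norm (u x) powr p \<le> c powr p * norm (v x) powr p"
    using le
  proof eventually_elim
    case (elim x)
    then have "norm (u x) powr p \<le> (c * norm (v x)) powr p" using p by (intro powr_mono2) auto
    then show ?case using c by (simp add: powr_mult)
  qed
  have ui: "integrable M (\<lambda>x. norm (u x) powr p)"
  proof (rule Bochner_Integration.integrable_bound[OF vi(1)])
    show "(\<lambda>x. norm (u x) powr p) \<in> borel_measurable M" using u by measurable
    show "AE x in M. norm (norm (u x) powr p) \<le> norm (c powr p * norm (v x) powr p)"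
      using AE by eventually_elim simp
  qed
  have "(LINT x|M. norm (u x) powr p) \<le> (LINT x|M. c powr p * norm (v x) powr p)"
    by (rule integral_mono_AE[OF ui vi(1) AE])
  also have "\<dots> = c powr p * (LINT x|M. norm (v x) powr p)" by simp
  also have "\<dots> \<le> c powr p * B powr p" using vi(2) by (intro mult_left_mono) auto
  also have "\<dots> = (c * B) powr p" using c B by (simp add: powr_mult)
  finally show ?thesis using p c B u ui by (subst Lp_le_iff) auto
qed

lemma Lp_le_cong_AE:
  assumes "1 < p" "Lp_le M p v B" "u \<in> borel_measurable M" "AE x in M. u x = v x"
  shows "Lp_le M p u B"
proof -
  have "AE x in M. norm (u x) \<le> 1 * norm (v x)" using assms(4) by eventually_elim simp
  from Lp_le_dominated[OF assms(1-3) _ this] show ?thesis by simp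
qed

lemma Lp_le_mult:
  assumes "1 < p" "Lp_le M p v B" "h \<in> borel_measurable M" "0 \<le> c" "\<And>x. v x = 0 \<or> norm (h x) \<le> c"
  shows "Lp_le M p (\<lambda>x. h x * v x) (c * B)"
proof (rule Lp_le_dominated[OF assms(1,2) _ assms(4)])
  show "(\<lambda>x. h x * v x) \<in> borel_measurable M"
    using assms(3) Lp_le_measurable[OF assms(2)] by measurable
  have "norm (h x * v x) \<le> c * norm (v x)" for x
    using assms(5)[of x] by (auto simp: norm_mult intro: mult_right_mono)
  then show "AE x in M. norm (h x * v x) \<le> c * norm (v x)" by simp
qed

lemma powr_convex_nonneg:
  fixes x y :: real
  assumes "1 < p" "0 \<le> s" "s \<le> 1" "0 \<le> x" "0 \<le> y"
  shows "(s * x + (1 - s) * y) powr p \<le> s * x powr p + (1 - s) * y powr p"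
proof -
  have scale: "(r * z) powr p \<le> r * z powr p" if "0 \<le> r" "r \<le> 1" "0 \<le> z" for r z :: real
  proof -
    have "r powr p \<le> r"
    proof (cases "r = 0")
      case False
      then have "r powr p \<le> r powr 1" using that assms by (intro powr_mono') auto
      then show ?thesis using that False by simp
    qed simp
    then have "r powr p * z powr p \<le> r * z powr p" by (rule mult_right_mono) simp
    then show ?thesis using that by (simp add: powr_mult)
  qed
  consider "x = 0" | "y = 0" | "0 < x" "0 < y" using assms by linarith
  then show ?thesis
  proof cases
    case 3
    then show ?thesis
      using convex_onD[OF powr_convex[of p], of "1 - s" x y] assms by simp
  qed (use scale[of s x] scale[of "1 - s" y] assms in auto)
qed

text \<open>Minkowski's inequality by convexity: (u + v) / (a + b) is the convex combination of u /
  a and v / b with weights a / (a + b) and b / (a + b). Vanishing bounds are reached by adding e / 2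
  to each and letting e tend to 0.\<close>

lemma Lp_le_add:
  assumes p: "1 < p" and u: "Lp_le M p u a" and v: "Lp_le M p v b"
  shows "Lp_le M p (\<lambda>x. u x + v x) (a + b)"
proof -
  have strict: "Lp_le M p (\<lambda>x. u x + v x) (a + b)"
    if u: "Lp_le M p u a" and v: "Lp_le M p v b" and a: "0 < a" and b: "0 < b" for a b
  proof -
    define s where "s = a / (a + b)"
    have s: "0 < s" "s < 1" "1 - s = b / (a + b)" using a b by (auto simp: s_def field_simps)
    have [measurable]: "u \<in> borel_measurable M" "v \<in> borel_measurable M"
      using u v Lp_le_measurable by blast+
    have ui: "integrable M (\<lambda>x. norm (u x) powr p)" "(LINT x|M. norm (u x) powr p) \<le> a powr p"
      and vi: "integrable M (\<lambda>x. norm (v x) powr p)" "(LINT x|M. norm (v x) powr p) \<le> b powr p"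
      using u v a b p by (auto simp: Lp_le_iff)
    define k where "k = (a + b) powr p"
    define ca where "ca = k * s / a powr p"
    define cb where "cb = k * (1 - s) / b powr p"
    have c0: "0 \<le> ca" "0 \<le> cb" using s a b by (auto simp: ca_def cb_def k_def)
    have pt: "norm (u x + v x) powr p \<le> ca * norm (u x) powr p + cb * norm (v x) powr p" for x
    proof -
      have "norm (u x + v x) \<le> (a + b) * (s * (norm (u x) / a) + (1 - s) * (norm (v x) / b))"
        unfolding s(3) unfolding s_def distrib_left using a b norm_triangle_ineq[of "u x" "v x"] by simp
      then have "norm (u x + v x) powr p \<le> ((a + b) * (s * (norm (u x) / a) + (1 - s) * (norm (v x) / b))) powr p"
        using p by (intro powr_mono2) auto
      also have "\<dots> = k * (s * (norm (u x) / a) + (1 - s) * (norm (v x) / b)) powr p"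
        using a b s by (simp add: powr_mult k_def)
      also have "\<dots> \<le> k * (s * (norm (u x) / a) powr p + (1 - s) * (norm (v x) / b) powr p)"
      proof (rule mult_left_mono)
        show "(s * (norm (u x) / a) + (1 - s) * (norm (v x) / b)) powr p
            \<le> s * (norm (u x) / a) powr p + (1 - s) * (norm (v x) / b) powr p"
          using p a b s by (intro powr_convex_nonneg) auto
      qed (simp add: k_def)
      also have "\<dots> = ca * norm (u x) powr p + cb * norm (v x) powr p"
        using a b by (simp add: powr_divide ca_def cb_def field_simps)
      finally show ?thesis .
    qed
    have dom: "integrable M (\<lambda>x. ca * norm (u x) powr p + cb * norm (v x) powr p)"
      using ui vi by auto
    have int: "integrable M (\<lambda>x. norm (u x + v x) powr p)"
      by (rule Bochner_Integration.integrable_bound[OF dom]) (use pt c0 in \<open>auto intro: order_trans[OF pt]\<close>)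
    have "(LINT x|M. norm (u x + v x) powr p) \<le> (LINT x|M. ca * norm (u x) powr p + cb * norm (v x) powr p)"
      by (rule integral_mono[OF int dom pt])
    also have "\<dots> = ca * (LINT x|M. norm (u x) powr p) + cb * (LINT x|M. norm (v x) powr p)"
      using ui vi by simp
    also have "\<dots> \<le> ca * a powr p + cb * b powr p"
      by (intro add_mono mult_left_mono ui vi c0)
    also have "\<dots> = (a + b) powr p"
    proof -
      have "ca * a powr p = k * s" "cb * b powr p = k * (1 - s)"
        using a b by (simp_all add: ca_def cb_def)
      then show ?thesis by (simp add: k_def algebra_simps)
    qed
    finally show ?thesis using a b p int by (subst Lp_le_iff) auto
  qed
  have ab: "0 \<le> a" "0 \<le> b" using u v Lp_le_nonneg by auto
  show ?thesis
    unfolding Lp_le_def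
  proof
    have "Lp_le M p (\<lambda>x. u x + v x) ((a + 1) + (b + 1))"
      by (rule strict) (use ab in \<open>auto intro: Lp_le_weaken[OF u] Lp_le_weaken[OF v]\<close>)
    then show "(\<lambda>x. u x + v x) \<in> Lp M p" by (simp add: Lp_le_def)
    show "Lp_norm M p (\<lambda>x. u x + v x) \<le> a + b"
    proof (rule field_le_epsilon)
      fix e :: real assume "0 < e"
      then have "Lp_le M p (\<lambda>x. u x + v x) ((a + e / 2) + (b + e / 2))"
        by (intro strict) (use ab in \<open>auto intro: Lp_le_weaken[OF u] Lp_le_weaken[OF v]\<close>)
      then show "Lp_norm M p (\<lambda>x. u x + v x) \<le> a + b + e" by (simp add: Lp_le_def)
    qed
  qed
qed

lemma Lp_le_cmult:
  assumes "1 < p" "Lp_le M p v B"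
  shows "Lp_le M p (\<lambda>x. c * v x) (norm c * B)"
  by (rule Lp_le_mult[OF assms]) auto

lemma Lp_le_diff:
  assumes "1 < p" "Lp_le M p u a" "Lp_le M p v b"
  shows "Lp_le M p (\<lambda>x. u x - v x) (a + b)"
  using Lp_le_add[OF assms(1,2) Lp_le_cmult[OF assms(1,3), of "-1"]] by simp

lemma Lp_le_sum:
  assumes "1 < p" "finite I" "\<And>i. i \<in> I \<Longrightarrow> Lp_le M p (u i) (b i)"
  shows "Lp_le M p (\<lambda>x. \<Sum>i\<in>I. u i x) (\<Sum>i\<in>I. b i)"
  using assms(2,3)
proof (induction I rule: finite_induct)
  case empty
  show ?case using assms(1) by (simp add: Lp_le_def Lp_def Lp_norm_def)
next
  case (insert i I)
  then show ?case using Lp_le_add[OF assms(1), of M "u i" "b i"] by simp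
qed

text \<open>Dominated convergence with the p-th power of u as majorant; it removes the cut-offs of
  input and output at the end.\<close>

lemma Lp_norm_tendsto_0:
  assumes p: "1 < p" and u: "u \<in> Lp M p" and [measurable]: "\<And>n. E n \<in> sets M"
    and ev: "\<And>x. \<forall>\<^sub>F n in sequentially. x \<in> E n"
  shows "(\<lambda>n. Lp_norm M p (\<lambda>x. indicator (- E n) x * u x)) \<longlonglongrightarrow> 0"
proof -
  have [measurable]: "u \<in> borel_measurable M" and ui: "integrable M (\<lambda>x. norm (u x) powr p)"
    using u by (auto simp: Lp_def)
  have "(\<lambda>n. LINT x|M. norm (indicator (- E n) x * u x) powr p) \<longlonglongrightarrow> (LINT x|M. 0)"
  proof (rule integral_dominated_convergence[OF _ _ ui])
    show "(\<lambda>x. norm (indicator (- E n) x * u x) powr p) \<in> borel_measurable M" for n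
      by measurable
    show "AE x in M. (\<lambda>n. norm (indicator (- E n) x * u x) powr p) \<longlonglongrightarrow> 0"
    proof (rule AE_I2)
      fix x
      have "\<forall>\<^sub>F n in sequentially. norm (indicator (- E n) x * u x) powr p = 0"
        using ev[of x] by (rule eventually_mono) (use p in auto)
      then show "(\<lambda>n. norm (indicator (- E n) x * u x) powr p) \<longlonglongrightarrow> 0" by (rule tendsto_eventually)
    qed
    show "AE x in M. norm (norm (indicator (- E n) x * u x) powr p) \<le> norm (u x) powr p" for n
      by (rule AE_I2) (auto split: split_indicator)
  qed auto
  then have "(\<lambda>n. (LINT x|M. norm (indicator (- E n) x * u x) powr p) powr (1 / p)) \<longlonglongrightarrow> 0 powr (1 / p)"
    using p by (intro tendsto_powr') auto
  then show ?thesis using p by (simp add: Lp_norm_def)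
qed

text \<open>The infimum in \<open>op_norm\<close> is not known in advance to be attained: every K
  above C is admissible, and K decreases to C for each fixed g.\<close>

lemma op_norm_le_D:
  assumes p: "1 < p" and T: "op_norm p T \<le> ennreal C" and C: "0 \<le> C" and g: "g \<in> Lp lebesgue p"
  shows "Lp_le lebesgue p (T g) (C * Lp_norm lebesgue p g)"
proof -
  have ex: "Lp_le lebesgue p (T g) (K * Lp_norm lebesgue p g)" if "C < K" for K
  proof -
    have "op_norm p T < ennreal K" using T that C by (intro le_less_trans[OF T]) (simp add: ennreal_less_iff)
    then obtain K' where K': "0 \<le> K'" "ennreal K' < ennreal K"
      "\<forall>g \<in> Lp lebesgue p. T g \<in> Lp lebesgue p \<and> Lp_norm lebesgue p (T g) \<le> K' * Lp_norm lebesgue p g"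
      unfolding op_norm_def Inf_less_iff by blast
    then have "K' \<le> K" by (simp add: ennreal_less_iff)
    then have "K' * Lp_norm lebesgue p g \<le> K * Lp_norm lebesgue p g" by (rule mult_right_mono) simp
    moreover have "Lp_le lebesgue p (T g) (K' * Lp_norm lebesgue p g)" using K' g by (simp add: Lp_le_def)
    ultimately show ?thesis using Lp_le_weaken by blast
  qed
  show ?thesis unfolding Lp_le_def
  proof
    show "T g \<in> Lp lebesgue p" using ex[of "C + 1"] by (simp add: Lp_le_def)
    show "Lp_norm lebesgue p (T g) \<le> C * Lp_norm lebesgue p g"
    proof (rule tendsto_lowerbound)
      show "((\<lambda>K. K * Lp_norm lebesgue p g) \<longlongrightarrow> C * Lp_norm lebesgue p g) (at_right C)"
        by (intro tendsto_intros)
      show "\<forall>\<^sub>F K in at_right C. Lp_norm lebesgue p (T g) \<le> K * Lp_norm lebesgue p g"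
        using ex by (auto simp: eventually_at_right_field Lp_le_def intro!: exI[of _ "C + 1"])
    qed simp
  qed
qed

lemma op_norm_le_I:
  assumes "0 \<le> C" "\<And>g. g \<in> Lp lebesgue p \<Longrightarrow> Lp_le lebesgue p (T g) (C * Lp_norm lebesgue p g)"
  shows "op_norm p T \<le> ennreal C"
  unfolding op_norm_def using assms by (intro Inf_lower) (auto simp: Lp_le_def)

section \<open>Cauchy estimates for polynomials from roots of unity\<close>

lemma poly_coeff_norm_le:
  fixes P :: "complex poly"
  assumes n: "degree P < n" and R: "0 < R" and k: "k < n"
  shows "norm (coeff P k) * R ^ k \<le> (\<Sum>j<n. norm (poly P (of_real R * cis (2 * pi * real j / real n)))) / n"
proof -
  define \<omega> where "\<omega> j = cis (2 * pi * real j / real n)" for j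
  have n0: "0 < n" using n by simp
  have \<omega>_pow: "\<omega> j ^ l = \<omega> l ^ j" for j l
  proof -
    have "real l * (2 * pi * real j / real n) = real j * (2 * pi * real l / real n)" by simp
    then show ?thesis by (simp only: \<omega>_def Complex.DeMoivre)
  qed
  have \<omega>_ne: "\<omega> j \<noteq> 0" for j by (simp add: \<omega>_def)
  \<comment> \<open>Orthogonality of the powers of the n-th roots of unity. Exponents below n belong
    to distinct roots, so with the degree below n no other coefficient mixes into the k-th
    one.\<close>
  have orth: "(\<Sum>j<n. \<omega> l ^ j / \<omega> k ^ j) = (if l = k then of_nat n else 0)" if l: "l < n" for l
  proof (cases "l = k")
    case False
    define q where "q = \<omega> l / \<omega> k"
    have "inj_on \<omega> {..<n}"
      using Complex.bij_betw_roots_unity[OF n0] unfolding \<omega>_def bij_betw_def by simp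
    then have "\<omega> l \<noteq> \<omega> k" using l k False by (auto simp: inj_on_def)
    then have q1: "q \<noteq> 1" using \<omega>_ne by (simp add: q_def)
    have "\<omega> j ^ n = 1" for j
      using n0 by (simp add: \<omega>_def Complex.DeMoivre cis_multiple_2pi mult.commute[of _ "2 * pi"])
    then have "q ^ n = 1" by (simp add: q_def power_divide)
    then have "(\<Sum>j<n. q ^ j) = 0" using geometric_sum[OF q1, of n] by simp
    then show ?thesis using False by (simp add: q_def power_divide)
  qed (use \<omega>_ne in simp)
  have poly_eq: "poly P z = (\<Sum>l<n. coeff P l * z ^ l)" for z
    unfolding poly_altdef
    by (rule sum.mono_neutral_left) (use n in \<open>auto simp: coeff_eq_0\<close>)
  have "(\<Sum>j<n. poly P (of_real R * \<omega> j) / \<omega> k ^ j)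
      = (\<Sum>j<n. \<Sum>l<n. coeff P l * of_real R ^ l * (\<omega> l ^ j / \<omega> k ^ j))"
    by (simp add: poly_eq power_mult_distrib sum_divide_distrib \<omega>_pow mult.assoc)
  also have "\<dots> = (\<Sum>l<n. coeff P l * of_real R ^ l * (\<Sum>j<n. \<omega> l ^ j / \<omega> k ^ j))"
    by (subst sum.swap) (simp add: sum_distrib_left)
  also have "\<dots> = (\<Sum>l<n. if l = k then coeff P l * of_real R ^ l * of_nat n else 0)"
    by (rule sum.cong) (auto simp: orth)
  also have "\<dots> = coeff P k * of_real R ^ k * of_nat n" using k by simp
  finally have "norm (coeff P k * of_real R ^ k * of_nat n) = norm (\<Sum>j<n. poly P (of_real R * \<omega> j) / \<omega> k ^ j)"
    by simp
  also have "\<dots> \<le> (\<Sum>j<n. norm (poly P (of_real R * \<omega> j) / \<omega> k ^ j))" by (rule norm_sum)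
  also have "\<dots> = (\<Sum>j<n. norm (poly P (of_real R * \<omega> j)))"
    by (simp add: norm_divide norm_power \<omega>_def)
  finally show ?thesis using n0 R by (simp add: norm_mult norm_power \<omega>_def field_simps)
qed

text \<open>The constant term cancels, the other coefficients obey the estimate above, and the
  geometric series of ratio \<bar>\<delta>\<bar> / R \<le> 1/2 has sum at most 2.\<close>

lemma poly_diff_le_average_on_circle:
  fixes P :: "complex poly" and \<delta> :: real
  assumes n: "degree P < n" and R: "0 < R" and \<delta>: "\<bar>\<delta>\<bar> \<le> R / 2"
  shows "norm (poly P (of_real \<delta>) - poly P 0)
    \<le> 2 * \<bar>\<delta>\<bar> / R * ((\<Sum>j<n. norm (poly P (of_real R * cis (2 * pi * real j / real n)))) / n)"
proof -
  define A where "A = (\<Sum>j<n. norm (poly P (of_real R * cis (2 * pi * real j / real n)))) / n"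
  have A: "0 \<le> A" by (simp add: A_def sum_nonneg)
  define r where "r = \<bar>\<delta>\<bar> / R"
  have r: "0 \<le> r" "r \<le> 1 / 2" using \<delta> R by (auto simp: r_def field_simps)
  obtain m where m: "n = Suc m" using n by (cases n) auto
  have poly_eq: "poly P z = (\<Sum>l<n. coeff P l * z ^ l)" for z
    unfolding poly_altdef
    by (rule sum.mono_neutral_left) (use n in \<open>auto simp: coeff_eq_0\<close>)
  have "poly P (of_real \<delta>) - poly P 0 = (\<Sum>l<m. coeff P (Suc l) * of_real \<delta> ^ Suc l)"
    unfolding poly_eq m sum.lessThan_Suc_shift by simp
  also have "norm \<dots> \<le> (\<Sum>l<m. norm (coeff P (Suc l) * of_real \<delta> ^ Suc l))" by (rule norm_sum)
  also have "\<dots> \<le> (\<Sum>l<m. A * r ^ Suc l)"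
  proof (rule sum_mono)
    fix l assume l: "l \<in> {..<m}"
    have "norm (coeff P (Suc l)) * R ^ Suc l \<le> A"
      unfolding A_def by (rule poly_coeff_norm_le[OF n R]) (use m l in auto)
    then have "norm (coeff P (Suc l)) * R ^ Suc l * r ^ Suc l \<le> A * r ^ Suc l"
      using r by (intro mult_right_mono) auto
    moreover have "R ^ Suc l * r ^ Suc l = \<bar>\<delta>\<bar> ^ Suc l"
      using R by (simp add: r_def power_divide)
    ultimately show "norm (coeff P (Suc l) * of_real \<delta> ^ Suc l) \<le> A * r ^ Suc l"
      by (simp add: norm_mult norm_power mult.assoc)
  qed
  also have "\<dots> = A * r * (\<Sum>l<m. r ^ l)" by (simp add: sum_distrib_left mult.assoc)
  also have "\<dots> \<le> A * r * 2"
  proof (rule mult_left_mono)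
    have "(\<Sum>l<m. r ^ l) = (1 - r ^ m) / (1 - r)" using r by (simp add: sum_gp_strict)
    also have "\<dots> \<le> 1 / (1 - r)" using r by (intro divide_right_mono) auto
    also have "\<dots> \<le> 2" using r by (simp add: field_simps)
    finally show "(\<Sum>l<m. r ^ l) \<le> 2" .
  qed (use A r in auto)
  finally show ?thesis by (simp add: A_def r_def mult_ac)
qed

section \<open>Conjugation by complex exponentials\<close>

text \<open>Applied with \<phi> = f / p and S = \<open>conj_op p w H\<close>, so that a real
  parameter x gives the conjugate for the weight \<open>w * exp (x * f)\<close>.\<close>

definition exp_conj :: "('a \<Rightarrow> real) \<Rightarrow> (('a \<Rightarrow> complex) \<Rightarrow> 'a \<Rightarrow> complex) \<Rightarrow> complex \<Rightarrow>
    ('a \<Rightarrow> complex) \<Rightarrow> 'a \<Rightarrow> complex" where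
  "exp_conj \<phi> S z g = (\<lambda>y. exp (z * of_real (\<phi> y)) * S (\<lambda>s. exp (- (z * of_real (\<phi> s))) * g s) y)"

text \<open>The bound is assumed at real parameters, where it is the weighted bound for a genuine
  weight. Additivity is assumed at each of them, since \<open>exp (- (x * \<phi>)) * g\<close> may
  lie outside \<open>Lp\<close>, where additivity of S on \<open>Lp\<close> says nothing.\<close>

locale exp_conjugation =
  fixes p R C :: real and \<phi> :: "'a::euclidean_space \<Rightarrow> real"
    and S :: "('a \<Rightarrow> complex) \<Rightarrow> 'a \<Rightarrow> complex"
  assumes p: "1 < p" and R: "0 < R" and C: "0 \<le> C"
    and \<phi> [measurable]: "\<phi> \<in> borel_measurable lebesgue"
    and real_bound: "\<And>x g. \<bar>x\<bar> \<le> R \<Longrightarrow> g \<in> Lp lebesgue p \<Longrightarrow>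
      Lp_le lebesgue p (exp_conj \<phi> S (of_real x) g) (C * Lp_norm lebesgue p g)"
    and real_add: "\<And>x u v. \<bar>x\<bar> \<le> R \<Longrightarrow> u \<in> Lp lebesgue p \<Longrightarrow> v \<in> Lp lebesgue p \<Longrightarrow>
      AE y in lebesgue. exp_conj \<phi> S (of_real x) (\<lambda>s. u s + v s) y = exp_conj \<phi> S (of_real x) u y + exp_conj \<phi> S (of_real x) v y"
    and scale: "\<And>c u. u \<in> Lp lebesgue p \<Longrightarrow> AE y in lebesgue. S (\<lambda>s. c * u s) y = c * S u y"
begin

abbreviation "T \<equiv> exp_conj \<phi> S"

lemma T_0: "T 0 = S"
  by (simp add: fun_eq_iff exp_conj_def)

lemma real_bound': "\<bar>x\<bar> \<le> R \<Longrightarrow> Lp_le lebesgue p g B \<Longrightarrow> Lp_le lebesgue p (T (of_real x) g) (C * B)"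
  by (rule Lp_le_weaken[OF real_bound]) (auto simp: Lp_le_def intro: mult_left_mono C)

lemma S_bound: "Lp_le lebesgue p g B \<Longrightarrow> Lp_le lebesgue p (S g) (C * B)"
  using real_bound'[of 0 g B] R by (simp add: T_0)

lemma S_add: "u \<in> Lp lebesgue p \<Longrightarrow> v \<in> Lp lebesgue p \<Longrightarrow>
    AE y in lebesgue. S (\<lambda>s. u s + v s) y = S u y + S v y"
  using real_add[of 0 u v] R by (simp add: T_0)

lemma cexp_measurable [measurable]: "(\<lambda>y. exp (z * complex_of_real (\<phi> y))) \<in> borel_measurable lebesgue"
proof -
  have "(exp :: complex \<Rightarrow> complex) \<in> borel_measurable borel"
    by (intro borel_measurable_continuous_onI continuous_intros)
  then show ?thesis by (rule measurable_compose[rotated]) measurable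
qed

text \<open>The imaginary part of the parameter only contributes unimodular factors, as \<open>\<phi>\<close> is real.\<close>

lemma T_bound:
  assumes z: "norm z \<le> R" and g: "Lp_le lebesgue p g B"
  shows "Lp_le lebesgue p (T z g) (C * B)"
proof -
  define x where "x = Re z"
  define w where "w = \<i> * of_real (Im z)"
  have z_eq: "z = of_real x + w" by (simp add: x_def w_def complex_eq_iff)
  have x: "\<bar>x\<bar> \<le> R" using abs_Re_le_cmod[of z] z by (simp add: x_def)
  define u where "u = (\<lambda>s. exp (- w * of_real (\<phi> s)) * g s)"
  have one: "norm (exp (w * complex_of_real (\<phi> y))) \<le> 1" "norm (exp (- w * complex_of_real (\<phi> y))) \<le> 1" for y
    by (simp_all add: w_def norm_exp_eq_Re)
  have "Lp_le lebesgue p u (1 * B)"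
    unfolding u_def by (rule Lp_le_mult[OF p g]) (use one in \<open>auto intro: cexp_measurable simp del: mult_minus_left\<close>)
  then have "Lp_le lebesgue p (T (of_real x) u) (C * B)" by (intro real_bound' x) simp
  then have "Lp_le lebesgue p (\<lambda>y. exp (w * of_real (\<phi> y)) * T (of_real x) u y) (1 * (C * B))"
    by (rule Lp_le_mult[OF p]) (use one in auto)
  moreover have "exp (w * of_real (\<phi> y)) * T (of_real x) u y = T z g y" for y
  proof -
    have neg: "exp (- (complex_of_real x * of_real (\<phi> s))) * exp (- w * of_real (\<phi> s)) = exp (- (z * of_real (\<phi> s)))" for s
      unfolding exp_add[symmetric] by (simp add: z_eq algebra_simps)
    have pos: "exp (w * of_real (\<phi> y)) * exp (complex_of_real x * of_real (\<phi> y)) = exp (z * of_real (\<phi> y))"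
      unfolding exp_add[symmetric] by (simp add: z_eq algebra_simps)
    show ?thesis by (simp only: exp_conj_def u_def mult.assoc[symmetric] neg pos)
  qed
  ultimately show ?thesis by simp
qed

lemma S_sum:
  assumes "finite I" "\<And>i. i \<in> I \<Longrightarrow> u i \<in> Lp lebesgue p" "I \<noteq> {}"
  shows "AE y in lebesgue. S (\<lambda>s. \<Sum>i\<in>I. c i * u i s) y = (\<Sum>i\<in>I. c i * S (u i) y)"
  using assms(1,3,2)
proof (induction I rule: finite_ne_induct)
  case (singleton i)
  then show ?case using scale[of "u i" "c i"] by simp
next
  case (insert i I)
  have cu: "(\<lambda>s. c j * u j s) \<in> Lp lebesgue p" if "j \<in> insert i I" for j
    using Lp_le_cmult[OF p Lp_le_refl, of "u j" lebesgue "c j"] insert.prems that by (simp add: Lp_le_def)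
  have "(\<lambda>s. \<Sum>i\<in>I. c i * u i s) \<in> Lp lebesgue p"
    using Lp_le_sum[OF p insert.hyps(1) Lp_le_refl, of "\<lambda>i s. c i * u i s" lebesgue] cu by (simp add: Lp_le_def)
  from S_add[OF cu this, of i]
  have "AE y in lebesgue. S (\<lambda>s. c i * u i s + (\<Sum>i\<in>I. c i * u i s)) y
      = S (\<lambda>s. c i * u i s) y + S (\<lambda>s. \<Sum>i\<in>I. c i * u i s) y" by simp
  moreover have "AE y in lebesgue. S (\<lambda>s. c i * u i s) y = c i * S (u i) y"
    using insert.prems by (intro scale) auto
  moreover have "AE y in lebesgue. S (\<lambda>s. \<Sum>i\<in>I. c i * u i s) y = (\<Sum>i\<in>I. c i * S (u i) y)"
    using insert.prems by (intro insert.IH) auto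
  ultimately show ?case
    by eventually_elim (use insert.hyps in simp)
qed

text \<open>On the set where \<open>\<bar>\<phi>\<bar> \<le> m\<close>, truncating both exponential series turns \<open>T z g\<close> pointwise into a
  polynomial in \<open>z\<close>, to which the estimate on a circle applies.\<close>

lemma truncated_difference:
  assumes \<delta>: "\<bar>\<delta>\<bar> \<le> R / 2" and m: "0 \<le> m" and g: "g \<in> Lp lebesgue p"
    and supp: "\<And>s. m < \<bar>\<phi> s\<bar> \<Longrightarrow> g s = 0"
  shows "Lp_norm lebesgue p (\<lambda>y. indicator {s. \<bar>\<phi> s\<bar> \<le> m} y * (T (of_real \<delta>) g y - T 0 g y))
    \<le> 2 * \<bar>\<delta>\<bar> / R * C * Lp_norm lebesgue p g"
proof -
  define G where "G = Lp_norm lebesgue p g"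
  have G: "0 \<le> G" "Lp_le lebesgue p g G" using g by (auto simp: G_def Lp_le_def)
  have g_meas [measurable]: "g \<in> borel_measurable lebesgue" using G Lp_le_measurable by blast
  define E where "E = {s. \<bar>\<phi> s\<bar> \<le> m}"
  have E [measurable]: "E \<in> sets lebesgue"
  proof -
    have "{s \<in> space lebesgue. \<bar>\<phi> s\<bar> \<le> m} \<in> sets lebesgue" by measurable
    then show ?thesis by (simp add: E_def)
  qed
  define \<Lambda> where "\<Lambda> = R * m"
  have \<Lambda>: "0 \<le> \<Lambda>" using R m by (simp add: \<Lambda>_def)
  define ee where "ee n \<zeta> = (\<Sum>k\<le>n. \<zeta> ^ k / fact k)" for n and \<zeta> :: complex
  \<comment> \<open>Bounds the Taylor remainder of the exponential on the disc of radius
    \<open>\<Lambda>\<close>, which contains z * \<phi> whenever \<bar>\<phi>\<bar> \<le> m and z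
    has modulus at most R.\<close>
  define \<tau> where "\<tau> n = exp \<Lambda> * \<Lambda> ^ Suc n / fact n" for n
  \<comment> \<open>The first term pays for truncating the outer exponential, with the inner one
    already truncated; the second for truncating the inner one under the exact outer factor. Each
    error passes through S once and so carries a factor C.\<close>
  define \<epsilon> where "\<epsilon> n = \<tau> n * (C * ((exp \<Lambda> + \<tau> n) * G)) + exp \<Lambda> * (C * (\<tau> n * G))" for n
  have \<tau>0: "0 \<le> \<tau> n" for n using \<Lambda> by (simp add: \<tau>_def)
  have \<tau>_lim: "\<tau> \<longlonglongrightarrow> 0"
  proof -
    have "(\<lambda>n. inverse (fact n) * \<Lambda> ^ n) \<longlonglongrightarrow> 0" by (rule summable_LIMSEQ_zero[OF summable_exp])
    then have "(\<lambda>n. exp \<Lambda> * \<Lambda> * (inverse (fact n) * \<Lambda> ^ n)) \<longlonglongrightarrow> exp \<Lambda> * \<Lambda> * 0" by (intro tendsto_intros)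
    then show ?thesis by (simp add: \<tau>_def[abs_def] field_simps)
  qed
  have \<epsilon>_lim: "\<epsilon> \<longlonglongrightarrow> 0"
  proof -
    have "\<epsilon> \<longlonglongrightarrow> 0 * (C * ((exp \<Lambda> + 0) * G)) + exp \<Lambda> * (C * (0 * G))"
      unfolding \<epsilon>_def[abs_def] by (intro tendsto_intros \<tau>_lim)
    then show ?thesis by simp
  qed
  have ee_exp: "norm (ee n \<zeta> - exp \<zeta>) \<le> \<tau> n" "norm (exp \<zeta>) \<le> exp \<Lambda>" "norm (ee n \<zeta>) \<le> exp \<Lambda> + \<tau> n"
    if \<zeta>: "norm \<zeta> \<le> \<Lambda>" for n \<zeta>
  proof -
    show 2: "norm (exp \<zeta>) \<le> exp \<Lambda>" using norm_exp[of \<zeta>] \<zeta> by (meson exp_le_cancel_iff order_trans)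
    have "norm (exp \<zeta> - ee n \<zeta>) \<le> exp (norm \<zeta>) * (norm \<zeta> ^ Suc n) / fact n"
      unfolding ee_def by (rule Taylor_exp_field)
    also have "\<dots> \<le> \<tau> n"
      unfolding \<tau>_def using \<zeta> \<Lambda> by (intro divide_right_mono mult_mono power_mono) auto
    finally show 1: "norm (ee n \<zeta> - exp \<zeta>) \<le> \<tau> n" by (simp add: norm_minus_commute)
    show "norm (ee n \<zeta>) \<le> exp \<Lambda> + \<tau> n"
      using norm_triangle_sub[of "ee n \<zeta>" "exp \<zeta>"] 1 2 by linarith
  qed
  have arg_le: "norm (z * complex_of_real (\<phi> s)) \<le> \<Lambda>" if "norm z \<le> R" "s \<in> E" for z s
    using that R unfolding \<Lambda>_def by (simp add: norm_mult E_def mult_mono)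
  have ee_meas [measurable]: "(\<lambda>y. ee n (z * complex_of_real (\<phi> y))) \<in> borel_measurable lebesgue" for n z
    unfolding ee_def by measurable
  have supp': "g s = 0 \<or> s \<in> E" for s using supp[of s] by (auto simp: E_def not_le)
  define u where "u k = (\<lambda>s. complex_of_real (\<phi> s) ^ k * g s)" for k :: nat
  have u: "u k \<in> Lp lebesgue p" for k
  proof -
    have "Lp_le lebesgue p (u k) (m ^ k * G)"
      unfolding u_def
    proof (rule Lp_le_mult[OF p G(2)])
      fix s
      show "g s = 0 \<or> norm (complex_of_real (\<phi> s) ^ k) \<le> m ^ k"
        using supp'[of s] by (auto simp: E_def norm_power intro: power_mono)
    qed (use m in auto)
    then show ?thesis by (simp add: Lp_le_def)
  qed
  have Su [measurable]: "S (u k) \<in> borel_measurable lebesgue" for k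
    using S_bound[OF Lp_le_refl[OF u]] by (rule Lp_le_measurable)
  \<comment> \<open>The functions \<open>S (u k)\<close> do not depend on z, so this formula is a
    polynomial in z at every point y. For each single z it represents the truncated conjugate almost
    everywhere, which suffices because \<open>close\<close> is a statement about norms.\<close>
  define P where "P n z y = indicator E y * (ee n (z * of_real (\<phi> y)) * (\<Sum>k\<le>n. (- z) ^ k / fact k * S (u k) y))"
    for n z y
  have P_meas [measurable]: "P n z \<in> borel_measurable lebesgue" for n z
    unfolding P_def by measurable
  have P_poly: "\<exists>q. degree q < 2 * n + 1 \<and> (\<forall>z. P n z y = poly q z)" for n y
  proof -
    define q1 where "q1 = (\<Sum>k\<le>n. monom (complex_of_real (\<phi> y) ^ k / fact k) k)"
    define q2 where "q2 = (\<Sum>k\<le>n. monom ((- 1) ^ k / fact k * S (u k) y) k)"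
    have d: "degree q1 \<le> n" "degree q2 \<le> n"
      unfolding q1_def q2_def by (auto intro!: degree_sum_le order_trans[OF degree_monom_le])
    have "degree (smult (indicator E y) (q1 * q2)) \<le> degree (q1 * q2)" by (rule degree_smult_le)
    also have "\<dots> \<le> degree q1 + degree q2" by (rule degree_mult_le)
    finally have "degree (smult (indicator E y) (q1 * q2)) < 2 * n + 1" using d by simp
    moreover have "P n z y = poly (smult (indicator E y) (q1 * q2)) z" for z
    proof -
      have "poly q1 z = ee n (z * of_real (\<phi> y))"
        by (simp add: q1_def ee_def poly_sum poly_monom power_mult_distrib mult.commute)
      moreover have "poly q2 z = (\<Sum>k\<le>n. (- z) ^ k / fact k * S (u k) y)"
        unfolding q2_def poly_sum poly_monom
        by (intro sum.cong refl) (simp add: power_minus[of z] field_simps)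
      ultimately show ?thesis by (simp add: P_def)
    qed
    ultimately show ?thesis by blast
  qed
  have close: "Lp_le lebesgue p (\<lambda>y. P n z y - indicator E y * T z g y) (\<epsilon> n)" if z: "norm z \<le> R" for n z
  proof -
    let ?e = "\<lambda>s. ee n (- z * of_real (\<phi> s))" and ?x = "\<lambda>s. exp (- z * complex_of_real (\<phi> s))"
    have mz: "norm (- z) \<le> R" using z by simp
    have e_g: "Lp_le lebesgue p (\<lambda>s. ?e s * g s) ((exp \<Lambda> + \<tau> n) * G)"
      by (rule Lp_le_mult[OF p G(2)])
        (use supp' ee_exp(3)[OF arg_le[OF mz]] \<tau>0[of n] ee_meas[of n "- z"] in \<open>auto intro: add_nonneg_nonneg\<close>)
    have x_g: "Lp_le lebesgue p (\<lambda>s. ?x s * g s) (exp \<Lambda> * G)"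
      by (rule Lp_le_mult[OF p G(2)])
        (use supp' ee_exp(2)[OF arg_le[OF mz]] in \<open>auto intro: cexp_measurable simp del: mult_minus_left\<close>)
    have d_g: "Lp_le lebesgue p (\<lambda>s. (?e s - ?x s) * g s) (\<tau> n * G)"
      by (rule Lp_le_mult[OF p G(2)])
        (use supp' ee_exp(1)[OF arg_le[OF mz]] \<tau>0[of n] borel_measurable_diff[OF ee_meas[of n "- z"] cexp_measurable[of "- z"]] in auto)
    define A where "A y = indicator E y * (ee n (z * of_real (\<phi> y)) - exp (z * of_real (\<phi> y))) * S (\<lambda>s. ?e s * g s) y" for y
    define B where "B y = indicator E y * exp (z * of_real (\<phi> y)) * S (\<lambda>s. (?e s - ?x s) * g s) y" for y
    have "Lp_le lebesgue p A (\<tau> n * (C * ((exp \<Lambda> + \<tau> n) * G)))"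
      unfolding A_def
      by (rule Lp_le_mult[OF p S_bound[OF e_g]])
        (use ee_exp(1)[OF arg_le[OF z]] \<tau>0[of n] in \<open>auto split: split_indicator\<close>)
    moreover have "Lp_le lebesgue p B (exp \<Lambda> * (C * (\<tau> n * G)))"
      unfolding B_def
      by (rule Lp_le_mult[OF p S_bound[OF d_g]])
        (use ee_exp(2)[OF arg_le[OF z]] in \<open>auto split: split_indicator\<close>)
    ultimately have AB: "Lp_le lebesgue p (\<lambda>y. A y + B y) (\<epsilon> n)"
      unfolding \<epsilon>_def by (rule Lp_le_add[OF p])
    have "(\<lambda>s. ?e s * g s) = (\<lambda>s. \<Sum>k\<le>n. (- z) ^ k / fact k * u k s)"
      unfolding ee_def u_def sum_distrib_right
      by (intro ext sum.cong refl) (simp only: power_mult_distrib times_divide_eq_left mult.assoc)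
    then have "AE y in lebesgue. S (\<lambda>s. ?e s * g s) y = (\<Sum>k\<le>n. (- z) ^ k / fact k * S (u k) y)"
      using S_sum[of "{..n}" u "\<lambda>k. (- z) ^ k / fact k"] u by simp
    moreover have "AE y in lebesgue. S (\<lambda>s. (?e s - ?x s) * g s + ?x s * g s) y
        = S (\<lambda>s. (?e s - ?x s) * g s) y + S (\<lambda>s. ?x s * g s) y"
      using d_g x_g by (intro S_add) (auto simp: Lp_le_def)
    then have "AE y in lebesgue. S (\<lambda>s. ?e s * g s) y = S (\<lambda>s. (?e s - ?x s) * g s) y + S (\<lambda>s. ?x s * g s) y"
      by (simp add: distrib_right[symmetric])
    ultimately have "AE y in lebesgue. P n z y - indicator E y * T z g y = A y + B y"
    proof eventually_elim
      case (elim y)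
      have "T z g y = exp (z * of_real (\<phi> y)) * S (\<lambda>s. ?x s * g s) y" by (simp add: exp_conj_def)
      moreover have "P n z y = indicator E y * (ee n (z * of_real (\<phi> y)) * S (\<lambda>s. ?e s * g s) y)"
        unfolding P_def elim(1) ..
      ultimately show ?case
        unfolding A_def B_def using elim(2) by (simp add: algebra_simps)
    qed
    moreover have "T z g \<in> borel_measurable lebesgue" using T_bound[OF z G(2)] by (rule Lp_le_measurable)
    then have "(\<lambda>y. P n z y - indicator E y * T z g y) \<in> borel_measurable lebesgue" by measurable
    ultimately show ?thesis using Lp_le_cong_AE[OF p AB] by blast
  qed
  have P_bound: "Lp_le lebesgue p (P n z) (\<epsilon> n + C * G)" if z: "norm z \<le> R" for n z
  proof -
    have "Lp_le lebesgue p (\<lambda>y. indicator E y * T z g y) (1 * (C * G))"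
      by (rule Lp_le_mult[OF p T_bound[OF z G(2)]]) (auto split: split_indicator)
    from Lp_le_add[OF p close[OF z] this] show ?thesis by simp
  qed
  define \<kappa> where "\<kappa> = 2 * \<bar>\<delta>\<bar> / R"
  have \<kappa>0: "0 \<le> \<kappa>" using R by (simp add: \<kappa>_def)
  have diff: "Lp_le lebesgue p (\<lambda>y. P n (of_real \<delta>) y - P n 0 y) (\<kappa> * (\<epsilon> n + C * G))" for n
  proof -
    \<comment> \<open>One node more than the degree bound 2n. The number of nodes grows with n, but
      the factor 1 / N of the average cancels the N summands.\<close>
    define N where "N = 2 * n + 1"
    have N: "0 < N" by (simp add: N_def)
    define z where "z j = of_real R * cis (2 * pi * real j / real N)" for j
    have z: "norm (z j) \<le> R" for j using R by (simp add: z_def norm_mult)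
    define V where "V y = (\<Sum>j<N. complex_of_real (norm (P n (z j) y)))" for y
    have "Lp_le lebesgue p (\<lambda>y. complex_of_real (norm (P n (z j) y))) (1 * (\<epsilon> n + C * G))" for j
      by (rule Lp_le_dominated[OF p P_bound[OF z[of j]]]) auto
    then have "Lp_le lebesgue p V (\<Sum>j<N. \<epsilon> n + C * G)"
      unfolding V_def by (intro Lp_le_sum p) auto
    then have V: "Lp_le lebesgue p V (real N * (\<epsilon> n + C * G))" by simp
    have "Lp_le lebesgue p (\<lambda>y. P n (of_real \<delta>) y - P n 0 y) (\<kappa> / N * (real N * (\<epsilon> n + C * G)))"
    proof (rule Lp_le_dominated[OF p V])
      show "AE y in lebesgue. norm (P n (of_real \<delta>) y - P n 0 y) \<le> \<kappa> / N * norm (V y)"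
      proof (rule AE_I2)
        fix y
        obtain q where q: "degree q < N" "\<And>z. P n z y = poly q z" using P_poly N_def by metis
        have "norm (poly q (of_real \<delta>) - poly q 0) \<le> \<kappa> * ((\<Sum>j<N. norm (poly q (z j))) / N)"
          unfolding \<kappa>_def z_def by (rule poly_diff_le_average_on_circle[OF q(1) R \<delta>])
        moreover have "norm (V y) = (\<Sum>j<N. norm (P n (z j) y))"
          unfolding V_def of_real_sum[symmetric] norm_of_real by (simp add: sum_nonneg)
        ultimately show "norm (P n (of_real \<delta>) y - P n 0 y) \<le> \<kappa> / N * norm (V y)" using q by simp
      qed
    qed (use \<kappa>0 in auto)
    then show ?thesis using N by simp
  qed
  have \<delta>R: "norm (complex_of_real \<delta>) \<le> R" using \<delta> R by simp
  have "Lp_norm lebesgue p (\<lambda>y. indicator E y * (T (of_real \<delta>) g y - T 0 g y))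
      \<le> \<kappa> * (\<epsilon> n + C * G) + \<epsilon> n + \<epsilon> n" for n
  proof -
    \<comment> \<open>Both operators are replaced by their polynomials; as n grows only
      \<open>\<kappa> * (C * G)\<close> survives.\<close>
    have "Lp_le lebesgue p (\<lambda>y. (P n (of_real \<delta>) y - P n 0 y) - (P n (of_real \<delta>) y - indicator E y * T (of_real \<delta>) g y)
        + (P n 0 y - indicator E y * T 0 g y)) (\<kappa> * (\<epsilon> n + C * G) + \<epsilon> n + \<epsilon> n)"
      using R by (intro Lp_le_add Lp_le_diff p diff close \<delta>R) auto
    then show ?thesis by (simp add: Lp_le_def algebra_simps)
  qed
  moreover have "(\<lambda>n. \<kappa> * (\<epsilon> n + C * G) + \<epsilon> n + \<epsilon> n) \<longlonglongrightarrow> \<kappa> * (0 + C * G) + 0 + 0"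
    by (intro tendsto_intros \<epsilon>_lim)
  ultimately have "Lp_norm lebesgue p (\<lambda>y. indicator E y * (T (of_real \<delta>) g y - T 0 g y)) \<le> \<kappa> * (0 + C * G) + 0 + 0"
    by (intro LIMSEQ_le_const) auto
  then show ?thesis by (simp add: E_def \<kappa>_def G_def mult.assoc)
qed

text \<open>Two limits remove the cut-offs, the truncated bound being independent of the level. For
  g supported where \<bar>\<phi>\<bar> \<le> k, the cut of the output is sent to infinity. A general
  g is then split at level m, and the image of its tail is controlled by the crude factor 2C times a
  norm tending to 0.\<close>

lemma difference_bound:
  assumes \<delta>: "\<bar>\<delta>\<bar> \<le> R / 2" and g: "g \<in> Lp lebesgue p"
  shows "Lp_le lebesgue p (\<lambda>y. T (of_real \<delta>) g y - T 0 g y) (2 * \<bar>\<delta>\<bar> / R * C * Lp_norm lebesgue p g)"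
proof -
  define E where "E m = {s. \<bar>\<phi> s\<bar> \<le> real m}" for m
  have E [measurable]: "E m \<in> sets lebesgue" for m
  proof -
    have "{s \<in> space lebesgue. \<bar>\<phi> s\<bar> \<le> real m} \<in> sets lebesgue" by measurable
    then show ?thesis by (simp add: E_def)
  qed
  have nE [measurable]: "- E m \<in> sets lebesgue" for m
    using sets.compl_sets[OF E[of m]] by (simp add: Compl_eq_Diff_UNIV)
  have ev: "\<forall>\<^sub>F m in sequentially. s \<in> E m" for s
  proof -
    obtain k :: nat where k: "\<bar>\<phi> s\<bar> \<le> real k" using real_arch_simple by blast
    have "s \<in> E m" if "k \<le> m" for m
    proof -
      have "\<bar>\<phi> s\<bar> \<le> real m" using k that by linarith
      then show ?thesis by (simp add: E_def)
    qed
    then show ?thesis unfolding eventually_sequentially by blast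
  qed
  define \<kappa> where "\<kappa> = 2 * \<bar>\<delta>\<bar> / R * C"
  have \<kappa>0: "0 \<le> \<kappa>" using R C by (simp add: \<kappa>_def)
  have \<delta>R: "\<bar>\<delta>\<bar> \<le> R" using \<delta> R by simp
  define D where "D g = (\<lambda>y. T (of_real \<delta>) g y - T 0 g y)" for g
  have D: "D g \<in> Lp lebesgue p" "Lp_norm lebesgue p (D g) \<le> 2 * C * Lp_norm lebesgue p g"
    if "g \<in> Lp lebesgue p" for g
  proof -
    have "Lp_le lebesgue p (D g) (C * Lp_norm lebesgue p g + C * Lp_norm lebesgue p g)"
      unfolding D_def using real_bound[OF \<delta>R that] real_bound[of 0, OF _ that] R by (intro Lp_le_diff p) auto
    then show "D g \<in> Lp lebesgue p" "Lp_norm lebesgue p (D g) \<le> 2 * C * Lp_norm lebesgue p g"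
      by (auto simp: Lp_le_def)
  qed
  have restr: "Lp_le lebesgue p (\<lambda>y. indicator A y * v y) (Lp_norm lebesgue p v)"
    if "v \<in> Lp lebesgue p" and [measurable]: "A \<in> sets lebesgue" for A v
  proof -
    have "Lp_le lebesgue p (\<lambda>y. indicator A y * v y) (1 * Lp_norm lebesgue p v)"
      by (rule Lp_le_mult[OF p Lp_le_refl[OF that(1)]]) (auto split: split_indicator)
    then show ?thesis by simp
  qed
  have supported: "Lp_norm lebesgue p (D g) \<le> \<kappa> * Lp_norm lebesgue p g"
    if g: "g \<in> Lp lebesgue p" and supp: "\<And>s. s \<notin> E k \<Longrightarrow> g s = 0" for g k
  proof -
    have "\<forall>\<^sub>F m in sequentially. Lp_norm lebesgue p (D g)
        \<le> \<kappa> * Lp_norm lebesgue p g + Lp_norm lebesgue p (\<lambda>y. indicator (- E m) y * D g y)"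
      using eventually_ge_at_top[of k]
    proof eventually_elim
      case (elim m)
      have "g s = 0" if "real m < \<bar>\<phi> s\<bar>" for s
      proof -
        have "real k < \<bar>\<phi> s\<bar>" using that elim by linarith
        then show ?thesis by (intro supp) (simp add: E_def)
      qed
      then have "Lp_norm lebesgue p (\<lambda>y. indicator (E m) y * D g y) \<le> \<kappa> * Lp_norm lebesgue p g"
        unfolding E_def D_def \<kappa>_def by (intro truncated_difference \<delta> g) auto
      then have 1: "Lp_le lebesgue p (\<lambda>y. indicator (E m) y * D g y) (\<kappa> * Lp_norm lebesgue p g)"
        using restr[OF D(1)[OF g] E] by (simp add: Lp_le_def)
      have 2: "Lp_le lebesgue p (\<lambda>y. indicator (- E m) y * D g y) (Lp_norm lebesgue p (\<lambda>y. indicator (- E m) y * D g y))"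
        by (rule Lp_le_refl) (use restr[OF D(1)[OF g] nE] in \<open>simp add: Lp_le_def\<close>)
      have "(\<lambda>y. indicator (E m) y * D g y + indicator (- E m) y * D g y) = D g"
        by (auto simp: fun_eq_iff split: split_indicator)
      with Lp_le_add[OF p 1 2] show ?case by (simp add: Lp_le_def)
    qed
    moreover have "(\<lambda>m. \<kappa> * Lp_norm lebesgue p g + Lp_norm lebesgue p (\<lambda>y. indicator (- E m) y * D g y))
        \<longlonglongrightarrow> \<kappa> * Lp_norm lebesgue p g + 0"
      by (intro tendsto_intros Lp_norm_tendsto_0 p D g E ev)
    ultimately show ?thesis
      by (intro tendsto_lowerbound[where F = sequentially]) auto
  qed
  have "Lp_norm lebesgue p (D g) \<le> \<kappa> * Lp_norm lebesgue p g
      + 2 * C * Lp_norm lebesgue p (\<lambda>y. indicator (- E m) y * g y)" for m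
  proof -
    let ?g1 = "\<lambda>y. indicator (E m) y * g y" and ?g2 = "\<lambda>y. indicator (- E m) y * g y"
    have g1: "Lp_le lebesgue p ?g1 (Lp_norm lebesgue p g)" by (rule restr[OF g E])
    have g2: "?g2 \<in> Lp lebesgue p" using restr[OF g nE] by (simp add: Lp_le_def)
    have g1': "?g1 \<in> Lp lebesgue p" using g1 by (simp add: Lp_le_def)
    have "Lp_norm lebesgue p (D ?g1) \<le> \<kappa> * Lp_norm lebesgue p ?g1"
      by (rule supported[OF g1', of m]) simp
    also have "\<dots> \<le> \<kappa> * Lp_norm lebesgue p g"
      using g1 \<kappa>0 by (intro mult_left_mono) (auto simp: Lp_le_def)
    finally have 1: "Lp_le lebesgue p (D ?g1) (\<kappa> * Lp_norm lebesgue p g)"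
      using D(1)[OF g1'] by (simp add: Lp_le_def)
    have 2: "Lp_le lebesgue p (D ?g2) (2 * C * Lp_norm lebesgue p ?g2)"
      using D[OF g2] by (simp add: Lp_le_def)
    have g_eq: "(\<lambda>y. ?g1 y + ?g2 y) = g" by (auto simp: fun_eq_iff split: split_indicator)
    have "AE y in lebesgue. T (of_real \<delta>) g y = T (of_real \<delta>) ?g1 y + T (of_real \<delta>) ?g2 y"
      using real_add[OF \<delta>R g1' g2] unfolding g_eq .
    moreover have "AE y in lebesgue. S g y = S ?g1 y + S ?g2 y"
      using S_add[OF g1' g2] unfolding g_eq .
    ultimately have "AE y in lebesgue. D g y = D ?g1 y + D ?g2 y"
      by eventually_elim (simp add: D_def T_0)
    from Lp_le_cong_AE[OF p Lp_le_add[OF p 1 2] _ this] D(1)[OF g]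
    show ?thesis by (simp add: Lp_le_def Lp_def)
  qed
  moreover have "(\<lambda>m. \<kappa> * Lp_norm lebesgue p g + 2 * C * Lp_norm lebesgue p (\<lambda>y. indicator (- E m) y * g y))
      \<longlonglongrightarrow> \<kappa> * Lp_norm lebesgue p g + 2 * C * 0"
    by (intro tendsto_intros Lp_norm_tendsto_0 p g E ev)
  ultimately have "Lp_norm lebesgue p (D g) \<le> \<kappa> * Lp_norm lebesgue p g + 2 * C * 0"
    by (intro LIMSEQ_le_const) auto
  then show ?thesis using D(1)[OF g] by (simp add: Lp_le_def D_def \<kappa>_def)
qed

end

section \<open>Application to the operator conjugated by weights\<close>

lemma conj_op_exp_weight:
  "conj_op p (\<lambda>y. w y * exp (x * f y)) H g = exp_conj (\<lambda>y. f y / p) (conj_op p w H) (of_real x) g"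
proof -
  have pos: "complex_of_real ((w y * exp (x * f y)) powr (1 / p))
      = exp (of_real x * of_real (f y / p)) * of_real (w y powr (1 / p))" for y
    unfolding powr_mult by (simp add: powr_def exp_of_real[symmetric])
  have neg: "complex_of_real ((w y * exp (x * f y)) powr (- 1 / p))
      = of_real (w y powr (- 1 / p)) * exp (- (of_real x * of_real (f y / p)))" for y
    unfolding powr_mult by (simp add: powr_def exp_of_real[symmetric])
  \<comment> \<open>Both sides apply H to literally the same function, so no change of
    representative is involved.\<close>
  show ?thesis unfolding conj_op_def exp_conj_def pos neg by (simp only: mult.assoc)
qed

text \<open>Ensures that \<open>conj_op\<close> evaluates H only on the weighted space where H is
  assumed linear.\<close>

lemma Lp_weight_power:
  fixes v :: "'a::euclidean_space \<Rightarrow> real"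
  assumes p: "1 < p" and v: "v \<in> Ap p" and u: "u \<in> Lp lebesgue p"
  shows "(\<lambda>y. of_real (v y powr (- 1 / p)) * u y) \<in> Lp (density lebesgue (\<lambda>x. ennreal (v x))) p"
proof -
  have [measurable]: "v \<in> borel_measurable lebesgue"
    using v by (auto simp: Ap_def weight_def intro: locally_integrable_measurable)
  have v0: "0 \<le> v y" for y using v by (simp add: Ap_def weight_def)
  have [measurable]: "u \<in> borel_measurable lebesgue" and ui: "integrable lebesgue (\<lambda>y. norm (u y) powr p)"
    using u by (auto simp: Lp_def)
  define a where "a = (\<lambda>y. complex_of_real (v y powr (- 1 / p)) * u y)"
  have [measurable]: "a \<in> borel_measurable lebesgue" unfolding a_def by measurable
  \<comment> \<open>Equality holds where v is positive; where v vanishes the left side is 0.\<close>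
  have le: "v y * norm (a y) powr p \<le> norm (u y) powr p" for y
  proof (cases "v y = 0")
    case False
    have "norm (a y) powr p = v y powr (- 1) * norm (u y) powr p"
      using p by (simp add: a_def norm_mult powr_mult powr_powr)
    then show ?thesis using False v0[of y] by (simp add: powr_minus mult.assoc[symmetric])
  qed simp
  have "integrable lebesgue (\<lambda>y. v y *\<^sub>R norm (a y) powr p)"
    by (rule Bochner_Integration.integrable_bound[OF ui]) (use le v0 in auto)
  then have "integrable (density lebesgue (\<lambda>x. ennreal (v x))) (\<lambda>y. norm (a y) powr p)"
    using v0 by (subst integrable_density) auto
  then show ?thesis unfolding a_def[symmetric] by (simp add: Lp_def)
qed

lemma conj_op_add:
  assumes p: "1 < p" and v: "v \<in> Ap p" and H: "weighted_linear_op p H"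
    and u: "u \<in> Lp lebesgue p" "u' \<in> Lp lebesgue p"
  shows "AE y in lebesgue. conj_op p v H (\<lambda>s. u s + u' s) y = conj_op p v H u y + conj_op p v H u' y"
proof -
  have "AE y in lebesgue. H (\<lambda>s. of_real (v s powr (- 1 / p)) * u s + of_real (v s powr (- 1 / p)) * u' s) y
      = H (\<lambda>s. of_real (v s powr (- 1 / p)) * u s) y + H (\<lambda>s. of_real (v s powr (- 1 / p)) * u' s) y"
    by (rule bspec[OF bspec[OF conjunct1[OF conjunct2[OF bspec[OF H[unfolded weighted_linear_op_def Let_def] v]]]]])
      (intro Lp_weight_power p v u)+
  then show ?thesis
    unfolding conj_op_def by eventually_elim (simp add: distrib_left)
qed

lemma conj_op_cmult:
  assumes p: "1 < p" and v: "v \<in> Ap p" and H: "weighted_linear_op p H" and u: "u \<in> Lp lebesgue p"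
  shows "AE y in lebesgue. conj_op p v H (\<lambda>s. c * u s) y = c * conj_op p v H u y"
proof -
  have "AE y in lebesgue. H (\<lambda>s. c * (of_real (v s powr (- 1 / p)) * u s)) y
      = c * H (\<lambda>s. of_real (v s powr (- 1 / p)) * u s) y"
    by (rule spec[OF bspec[OF conjunct2[OF conjunct2[OF bspec[OF H[unfolded weighted_linear_op_def Let_def] v]]]]])
      (intro Lp_weight_power p v u)
  then show ?thesis
    unfolding conj_op_def by eventually_elim (simp add: mult.left_commute)
qed

text \<open>The order of the quantifiers expresses the dependence of the constants: the radius is
  fixed from p, A, N and the dimension, and C is chosen after F but before w, f and H.\<close>

theorem theorem2:
  fixes p A N :: real
  assumes "1 < p"
  shows "\<exists>\<delta>\<^sub>0>0. \<forall>F :: real \<Rightarrow> real \<Rightarrow> real. continuous_on {1..} (\<lambda>t. F t p) \<longrightarrow>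
    (\<exists>C::real. \<forall>(w :: real ^ 'n \<Rightarrow> real) (f :: real ^ 'n \<Rightarrow> real)
        (H :: (real ^ 'n \<Rightarrow> complex) \<Rightarrow> real ^ 'n \<Rightarrow> complex).
      w \<in> Ap p \<and> enn2real (Ap_const p w) = A \<and>
      f \<in> BMO \<and> enn2real (BMO_norm f) = N \<and>
      weighted_linear_op p H \<and>
      (\<forall>v \<in> Ap p. op_norm p (conj_op p v H) \<le> ennreal (F (enn2real (Ap_const p v)) p))
      \<longrightarrow> (\<forall>\<delta>. \<bar>\<delta>\<bar> < \<delta>\<^sub>0 \<longrightarrow>
            op_norm p (\<lambda>g x. conj_op p (\<lambda>y. w y * exp (\<delta> * f y)) H g x - conj_op p w H g x)
              \<le> ennreal (C * \<bar>\<delta>\<bar>)))"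
proof -
  note p = assms
  obtain R M where R: "0 < R" and RM: "\<forall>(w :: real ^ 'n \<Rightarrow> real) f. w \<in> Ap p \<longrightarrow> enn2real (Ap_const p w) = A \<longrightarrow>
     f \<in> BMO \<longrightarrow> enn2real (BMO_norm f) = N \<longrightarrow> (\<forall>x. \<bar>x\<bar> \<le> R \<longrightarrow>
       (\<lambda>y. w y * exp (x * f y)) \<in> Ap p \<and> enn2real (Ap_const p (\<lambda>y. w y * exp (x * f y))) \<le> M)"
    using exp_BMO_perturbation_Ap[OF p, where ?'a = "real ^ 'n", of A N] by (elim exE conjE)
  show ?thesis
  proof (rule exI[of _ "R / 2"], intro conjI allI impI)
    \<comment> \<open>Half the radius of the disc of bounded parameters, as the geometric series in
      Cauchy's estimate needs \<bar>\<delta>\<bar> / R \<le> 1/2.\<close>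
    show "0 < R / 2" using R by simp
    fix F :: "real \<Rightarrow> real \<Rightarrow> real" assume F: "continuous_on {1..} (\<lambda>t. F t p)"
    \<comment> \<open>A compact interval containing the constants of all perturbed weights with
      \<bar>x\<bar> \<le> R; the maximum with 1 keeps it nonempty.\<close>
    have "continuous_on {1..max 1 M} (\<lambda>t. F t p)" by (rule continuous_on_subset[OF F]) auto
    then have "\<exists>s\<in>{1..max 1 M}. \<forall>t\<in>{1..max 1 M}. F t p \<le> F s p"
      by (intro continuous_attains_sup) auto
    then obtain s where s: "\<And>t. t \<in> {1..max 1 M} \<Longrightarrow> F t p \<le> F s p" by blast
    \<comment> \<open>F may be negative, and \<open>ennreal\<close> sends negative numbers to
      0.\<close>
    define C where "C = max 0 (F s p)"
    have C: "0 \<le> C" by (simp add: C_def)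
    show "\<exists>C::real. \<forall>(w :: real ^ 'n \<Rightarrow> real) (f :: real ^ 'n \<Rightarrow> real)
        (H :: (real ^ 'n \<Rightarrow> complex) \<Rightarrow> real ^ 'n \<Rightarrow> complex).
      w \<in> Ap p \<and> enn2real (Ap_const p w) = A \<and>
      f \<in> BMO \<and> enn2real (BMO_norm f) = N \<and>
      weighted_linear_op p H \<and>
      (\<forall>v \<in> Ap p. op_norm p (conj_op p v H) \<le> ennreal (F (enn2real (Ap_const p v)) p))
      \<longrightarrow> (\<forall>\<delta>. \<bar>\<delta>\<bar> < R / 2 \<longrightarrow>
            op_norm p (\<lambda>g x. conj_op p (\<lambda>y. w y * exp (\<delta> * f y)) H g x - conj_op p w H g x)
              \<le> ennreal (C * \<bar>\<delta>\<bar>))"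
    proof (intro exI[of _ "2 / R * C"] allI impI, elim conjE)
      fix w f :: "real ^ 'n \<Rightarrow> real" and H :: "(real ^ 'n \<Rightarrow> complex) \<Rightarrow> real ^ 'n \<Rightarrow> complex" and \<delta> :: real
      assume w: "w \<in> Ap p" and wA: "enn2real (Ap_const p w) = A"
        and f: "f \<in> BMO" and fN: "enn2real (BMO_norm f) = N"
        and H: "weighted_linear_op p H"
        and bound: "\<forall>v \<in> Ap p. op_norm p (conj_op p v H) \<le> ennreal (F (enn2real (Ap_const p v)) p)"
        and \<delta>: "\<bar>\<delta>\<bar> < R / 2"
      note pert = RM[rule_format, OF w wA f fN]
      have "f \<in> borel_measurable lebesgue"
        using f by (auto simp: BMO_def intro: locally_integrable_measurable)
      interpret exp_conjugation p R C "\<lambda>y. f y / p" "conj_op p w H"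
      proof
        show "1 < p" "0 < R" "0 \<le> C" by fact+
        show "(\<lambda>y. f y / p) \<in> borel_measurable lebesgue"
          using \<open>f \<in> borel_measurable lebesgue\<close> by measurable
      next
        fix x :: real and g :: "real ^ 'n \<Rightarrow> complex" assume x: "\<bar>x\<bar> \<le> R" and g: "g \<in> Lp lebesgue p"
        let ?v = "\<lambda>y. w y * exp (x * f y)"
        have v: "?v \<in> Ap p" "enn2real (Ap_const p ?v) \<in> {1..max 1 M}"
          using pert[OF x] Ap_const_ge_1[OF p, of ?v] by auto
        have "op_norm p (conj_op p ?v H) \<le> ennreal (F (enn2real (Ap_const p ?v)) p)" using bound v(1) by blast
        also have "\<dots> \<le> ennreal C" using s[OF v(2)] by (intro ennreal_leI) (simp add: C_def)
        finally show "Lp_le lebesgue p (exp_conj (\<lambda>y. f y / p) (conj_op p w H) (of_real x) g) (C * Lp_norm lebesgue p g)"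
          unfolding conj_op_exp_weight[symmetric] by (intro op_norm_le_D p C g)
      next
        fix x :: real and u v :: "real ^ 'n \<Rightarrow> complex"
        assume "\<bar>x\<bar> \<le> R" "u \<in> Lp lebesgue p" "v \<in> Lp lebesgue p"
        then show "AE y in lebesgue. exp_conj (\<lambda>y. f y / p) (conj_op p w H) (of_real x) (\<lambda>s. u s + v s) y
            = exp_conj (\<lambda>y. f y / p) (conj_op p w H) (of_real x) u y
              + exp_conj (\<lambda>y. f y / p) (conj_op p w H) (of_real x) v y"
          unfolding conj_op_exp_weight[symmetric] using pert by (intro conj_op_add p H) auto
      next
        fix c and u :: "real ^ 'n \<Rightarrow> complex" assume "u \<in> Lp lebesgue p"
        then show "AE y in lebesgue. conj_op p w H (\<lambda>s. c * u s) y = c * conj_op p w H u y"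
          by (rule conj_op_cmult[OF p w H])
      qed
      show "op_norm p (\<lambda>g x. conj_op p (\<lambda>y. w y * exp (\<delta> * f y)) H g x - conj_op p w H g x)
              \<le> ennreal (2 / R * C * \<bar>\<delta>\<bar>)"
      proof (rule op_norm_le_I)
        fix g :: "real ^ 'n \<Rightarrow> complex" assume "g \<in> Lp lebesgue p"
        from difference_bound[OF _ this, of \<delta>]
        show "Lp_le lebesgue p (\<lambda>x. conj_op p (\<lambda>y. w y * exp (\<delta> * f y)) H g x - conj_op p w H g x)
            (2 / R * C * \<bar>\<delta>\<bar> * Lp_norm lebesgue p g)"
          using \<delta> by (simp add: conj_op_exp_weight T_0 mult_ac)
      qed (use R C in auto)
    qed
  qed
qed

end
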